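(* Let $d,n\ge1$ be integers, $\lambda_1,\dots,\lambda_n\ge0$ with $\sum_{i=1}^n\lambda_i=1$, $\gamma\ge0$, and $0<\alpha\le\beta$. Let $A_1,\dots,A_n\in\mathbb{S}(d,\mathbb{R})_+$ satisfy $\alpha I\le A_i\le\beta I$ for all $i$. (a) (Gaussian case, $\mu_i=\mathcal{N}(0,A_i)$.) For all $X\neq Y$ in $\mathbb{S}(d,\mathbb{R})_+$ with $\alpha I\le X\le\beta I$ and $\alpha I\le Y\le \beta I$, $$\frac{\|\nabla f(X)-\nabla f(Y)\|_F}{\|X-Y\|_F}\le\frac{\beta^2}{2\alpha^3}+\frac{\gamma}{\alpha^2}.$$ (b) ($q$-Gaussian case, $\mu_i=G_q(0,A_i)$.) Let $q\in(0,1)\cup\big(1,\frac{d+4}{d+2}\big)$. For all $X\ne Y$ in $\mathbb{S}(d,\mathbb{R})_+$ with $\alpha I\le X\le\beta I$ and $\alpha I\le Y\le\beta I$, $$\frac{\|\nabla g(X)-\nabla g(Y)\|_F}{\|X-Y\|_F}\le\begin{cases}\dfrac{\beta^2}{2\alpha^3}+\dfrac{\gamma}{\alpha^2}+\dfrac{\gamma\, m(q,d)}{\alpha^2}\,\beta^{\frac{q-1}{2}d}\Big(1+\dfrac{q-1}{2}d\Big),&\text{if }1<q<\frac{d+4}{d+2},\\[3mm]\dfrac{\beta^2}{2\alpha^3}+\dfrac{\gamma}{\alpha^2}+\gamma\, m(q,d)\,\alpha^{-2+\frac{q-1}{2}d}\Big(1+\dfrac{1-q}{2}d\Big),&\text{if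 }0<q<1.\end{cases}$$ In particular, on the set $\{X:\alpha I\le X\le\beta I\}$, the gradient of the objective function is Lipschitz continuous in each case.
   Context: $\mathbb{S}(d,\mathbb{R})_+$ is the set of real symmetric positive definite $d\times d$ matrices; $\le$ is the Loewner order; $X^{1/2}$ is the positive definite square root. Gradients are taken with respect to the Frobenius inner product $\langle X,Y\rangle=\mathrm{tr}(X^TY)$ on symmetric matrices, and $\|X\|_F=(\mathrm{tr}(X^TX))^{1/2}$. The objective functions come from the problem $\min_\mu\sum_i\frac12\lambda_iW_2^2(\mu,\mu_i)+\gamma F(\mu)$ ($W_2$ the $L^2$-Wasserstein distance), restricted to mean-zero Gaussian measures $\mu=\mathcal{N}(0,X)$ with $F$ the negative Boltzmann entropy $\int\mu\log\mu\,dx$, resp. to mean-zero $q$-Gaussian measures $\mu=G_q(0,X)$ with $F=F_q$ the Tsallis entropy $\frac1{1-q}\int[\mu(x)^{1-q}-1]\mu(x)\,dx$. In terms of the covariance matrix $X\in\mathbb{S}(d,\mathbb{R})_+$ the objectives are $\frac12f(X)$, resp. $\frac12g(X)$, where, with $$f_1(X)=\sum_{i=1}^n\lambda_i\,\mathrm{tr}A_i+\sum_{i=1}^n\lambda_i\,\mathrm{tr}\Big(X-2\big(A_i^{1/2}XA_i^{1/2}\big)^{1/2}\Big),$$ $$f(X)=f_1(X)-\gamma\ln\det X-\gamma d\ln(2\pi e),$$ $$g(X)=f_1(X)+\gamma\big[2-(1-q)d\,C_1(q,d)\big]\ln_q\frac{C_0(q,d)}{(\det X)^{1/2}}-\gamma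 d\,C_1(q,d).$$ Here $\ln_q(t)=\frac{t^{1-q}-1}{1-q}$, and $G_q(0,V)$ is the probability measure with density $C_0(q,d)(\det V)^{-1/2}\exp_q(-\frac12C_1(q,d)\langle x,V^{-1}x\rangle)$, where $\exp_q(t)=(\max\{0,1+(1-q)t\})^{1/(1-q)}$, $$C_1(q,d)=\frac{2}{2+(d+2)(1-q)},\qquad C_0(q,d)=\begin{cases}\dfrac{\Gamma\big(\frac{2-q}{1-q}+\frac d2\big)}{\Gamma\big(\frac{2-q}{1-q}\big)}\Big(\dfrac{(1-q)C_1(q,d)}{2\pi}\Big)^{d/2}&0<q<1,\\[2mm] \dfrac{\Gamma\big(\frac1{q-1}\big)}{\Gamma\big(\frac1{q-1}-\frac d2\big)}\Big(\dfrac{(q-1)C_1(q,d)}{2\pi}\Big)^{d/2}&1<q<\frac{d+4}{d+2}.\end{cases}$$ Finally $m(q,d)=\dfrac{2(2-q)C_0(q,d)^{1-q}}{2+(d+2)(1-q)}$. *)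

theory Defs
  imports "HOL-Analysis.Analysis"
begin

text \<open>
  The dimension \<open>d \<ge> 1\<close> is \<open>CARD('d)\<close>. The library inner product and norm on
  \<^typ>\<open>real^'d^'d\<close> are the Frobenius ones:
\<close>

lemma inner_matrix_eq_trace: "X \<bullet> Y = trace (transpose X ** Y)" for X Y :: "real^'d^'d"
proof -
  have "X \<bullet> Y = (\<Sum>i\<in>UNIV. \<Sum>j\<in>UNIV. X$i$j * Y$i$j)"
    by (simp add: inner_vec_def)
  also have "\<dots> = (\<Sum>j\<in>UNIV. \<Sum>i\<in>UNIV. X$i$j * Y$i$j)"
    by (rule sum.swap)
  also have "\<dots> = trace (transpose X ** Y)"
    by (simp add: trace_def matrix_matrix_mult_def transpose_def)
  finally show ?thesis .
qed

lemma norm_matrix_eq_trace: "norm X = sqrt (trace (transpose X ** X))" for X :: "real^'d^'d"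
  by (simp add: norm_eq_sqrt_inner inner_matrix_eq_trace)

definition sym_matrices :: "(real^'d^'d) set" where
  "sym_matrices = {X. transpose X = X}"

definition spd :: "real^'d^'d \<Rightarrow> bool" where
  "spd X \<longleftrightarrow> X \<in> sym_matrices \<and> (\<forall>v. v \<noteq> 0 \<longrightarrow> v \<bullet> (X *v v) > 0)"

definition psd :: "real^'d^'d \<Rightarrow> bool" where
  "psd X \<longleftrightarrow> X \<in> sym_matrices \<and> (\<forall>v. v \<bullet> (X *v v) \<ge> 0)"

definition loewner_le :: "real^'d^'d \<Rightarrow> real^'d^'d \<Rightarrow> bool" where
  "loewner_le X Y \<longleftrightarrow> psd (Y - X)"

definition spd_between :: "real \<Rightarrow> real \<Rightarrow> (real^'d^'d) set" where
  "spd_between \<alpha> \<beta> = {X. spd X \<and> loewner_le (mat \<alpha>) X \<and> loewner_le X (mat \<beta>)}"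

text \<open>Only meaningful for positive definite arguments.\<close>

definition spd_sqrt :: "real^'d^'d \<Rightarrow> real^'d^'d" where
  "spd_sqrt X = (THE R. spd R \<and> R ** R = X)"

text \<open>
  Gradients are those of functions on the space of symmetric matrices, so the derivative is
  taken within that space and the representing matrix is itself symmetric. (The
  functions below need not be differentiable, or even sensibly defined, at
  non-symmetric matrices near \<open>X\<close>.)
\<close>

definition has_sym_gradient ::
    "(real^'d^'d \<Rightarrow> real) \<Rightarrow> real^'d^'d \<Rightarrow> real^'d^'d \<Rightarrow> bool" where
  "has_sym_gradient f G X \<longleftrightarrow>
     G \<in> sym_matrices \<and> (f has_derivative (\<lambda>H. G \<bullet> H)) (at X within sym_matrices)"

definition sym_grad :: "(real^'d^'d \<Rightarrow> real) \<Rightarrow> real^'d^'d \<Rightarrow> real^'d^'d" where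
  "sym_grad f X = (THE G. has_sym_gradient f G X)"

lemma sym_matrices_add_scaleR:
  "X \<in> sym_matrices \<Longrightarrow> H \<in> sym_matrices \<Longrightarrow> X + t *\<^sub>R H \<in> sym_matrices"
  by (simp add: sym_matrices_def transpose_def vec_eq_iff)

lemma has_sym_gradient_unique:
  assumes "X \<in> sym_matrices" "has_sym_gradient f G X" "has_sym_gradient f G' X"
  shows "G = G'"
proof -
  have line: "((\<lambda>t. f (X + t *\<^sub>R H)) has_derivative (\<lambda>t. D \<bullet> (t *\<^sub>R H))) (at 0)"
    if H: "H \<in> sym_matrices" and D: "has_sym_gradient f D X" for H D
  proof -
    have l: "((\<lambda>t. X + t *\<^sub>R H) has_derivative (\<lambda>t. t *\<^sub>R H)) (at 0)"
      by (auto intro!: derivative_eq_intros)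
    have d: "(f has_derivative (\<lambda>H. D \<bullet> H)) (at (X + 0 *\<^sub>R H) within range (\<lambda>t. X + t *\<^sub>R H))"
      using D assms(1) H sym_matrices_add_scaleR
      by (auto simp: has_sym_gradient_def intro!: has_derivative_subset[of f _ X sym_matrices])
    show ?thesis
      using has_derivative_in_compose[OF l d] by simp
  qed
  have GG: "G \<in> sym_matrices" "G' \<in> sym_matrices"
    using assms by (auto simp: has_sym_gradient_def)
  have H: "G - G' \<in> sym_matrices"
    using sym_matrices_add_scaleR[OF GG, of "-1"] by simp
  have "(\<lambda>t. G \<bullet> (t *\<^sub>R (G - G'))) = (\<lambda>t. G' \<bullet> (t *\<^sub>R (G - G')))"
    by (rule has_derivative_unique[OF line[OF H assms(2)] line[OF H assms(3)]])
  then have "G \<bullet> (G - G') = G' \<bullet> (G - G')"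
    by (metis scaleR_one)
  then have "(G - G') \<bullet> (G - G') = 0"
    by (simp add: inner_diff_left)
  then show ?thesis by simp
qed

lemma sym_grad_eqI: "X \<in> sym_matrices \<Longrightarrow> has_sym_gradient f G X \<Longrightarrow> sym_grad f X = G"
  unfolding sym_grad_def using has_sym_gradient_unique by blast

definition ln_q :: "real \<Rightarrow> real \<Rightarrow> real" where
  "ln_q q t = (t powr (1 - q) - 1) / (1 - q)"

definition C1 :: "real \<Rightarrow> nat \<Rightarrow> real" where
  "C1 q d = 2 / (2 + (real d + 2) * (1 - q))"

text \<open>Only meaningful for \<open>0 < q < 1\<close> and \<open>1 < q < (d + 4) / (d + 2)\<close>.\<close>

definition C0 :: "real \<Rightarrow> nat \<Rightarrow> real" where
  "C0 q d =
    (if q < 1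
     then Gamma ((2 - q) / (1 - q) + real d / 2) / Gamma ((2 - q) / (1 - q))
            * ((1 - q) * C1 q d / (2 * pi)) powr (real d / 2)
     else Gamma (1 / (q - 1)) / Gamma (1 / (q - 1) - real d / 2)
            * ((q - 1) * C1 q d / (2 * pi)) powr (real d / 2))"

definition m_const :: "real \<Rightarrow> nat \<Rightarrow> real" where
  "m_const q d = 2 * (2 - q) * C0 q d powr (1 - q) / (2 + (real d + 2) * (1 - q))"

text \<open>
  \<open>f_gauss\<close> and \<open>g_qgauss\<close> are twice the objectives \<open>\<Sum>\<^sub>i \<lambda>\<^sub>i/2 W\<^sub>2\<^sup>2(\<mu>, \<mu>\<^sub>i) + \<gamma> F(\<mu>)\<close> as functions
  of the covariance matrix of \<open>\<mu>\<close>: for \<open>\<mu> = N(0, X)\<close> and the Boltzmann entropy, and for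
  \<open>\<mu> = G\<^sub>q(0, X)\<close> and the Tsallis entropy, respectively.
\<close>

definition f1 :: "nat \<Rightarrow> (nat \<Rightarrow> real) \<Rightarrow> (nat \<Rightarrow> real^'d^'d) \<Rightarrow> real^'d^'d \<Rightarrow> real" where
  "f1 n lam A X =
     (\<Sum>i=1..n. lam i * trace (A i))
     + (\<Sum>i=1..n. lam i *
          trace (X - 2 *\<^sub>R spd_sqrt (spd_sqrt (A i) ** X ** spd_sqrt (A i))))"

definition f_gauss ::
    "nat \<Rightarrow> (nat \<Rightarrow> real) \<Rightarrow> (nat \<Rightarrow> real^'d^'d) \<Rightarrow> real \<Rightarrow> real^'d^'d \<Rightarrow> real" where
  "f_gauss n lam A \<gamma> X =
     f1 n lam A X - \<gamma> * ln (det X) - \<gamma> * real CARD('d) * ln (2 * pi * exp 1)"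

definition g_qgauss ::
    "nat \<Rightarrow> (nat \<Rightarrow> real) \<Rightarrow> (nat \<Rightarrow> real^'d^'d) \<Rightarrow> real \<Rightarrow> real \<Rightarrow> real^'d^'d \<Rightarrow> real" where
  "g_qgauss n lam A \<gamma> q X =
     f1 n lam A X
     + \<gamma> * (2 - (1 - q) * real CARD('d) * C1 q CARD('d))
         * ln_q q (C0 q CARD('d) / sqrt (det X))
     - \<gamma> * real CARD('d) * C1 q CARD('d)"

end

theory Submission
  imports Defs
begin

text \<open>
  Write \<open>S\<^sub>i\<close> for the square root of \<open>A\<^sub>i\<close> and \<open>K\<^sub>i(X)\<close> for that of \<open>S\<^sub>i X S\<^sub>i\<close>. The Wasserstein part
  of the objective has gradient \<open>\<Sum>\<^sub>i \<lambda>\<^sub>i (I - T\<^sub>i(X))\<close>, where \<open>T\<^sub>i(X) = S\<^sub>i (inv K\<^sub>i(X)) S\<^sub>i\<close> is the optimal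
  transport map from the covariance \<open>X\<close> to \<open>A\<^sub>i\<close>. Since \<open>S\<^sub>i X S\<^sub>i \<ge> \<alpha>\<^sup>2 I\<close>, also \<open>K\<^sub>i(X) \<ge> \<alpha> I\<close>. Passing from
  \<open>X\<close> to \<open>S\<^sub>i X S\<^sub>i\<close> costs a factor \<open>\<beta>\<close>, taking the root \<open>1 / (2 \<alpha>)\<close>, inverting \<open>1 / \<alpha>\<^sup>2\<close>, and the outer
  conjugation \<open>\<beta>\<close> again; the product is \<open>\<beta>\<^sup>2 / (2 \<alpha>\<^sup>3)\<close> (\<open>transport_matrix_lipschitz\<close>). A convex
  combination of the \<open>T\<^sub>i\<close> does not increase it.

  Square roots are handled through the identity \<open>K\<^sup>2 - L\<^sup>2 = K (K - L) + (K - L) L\<close>: paired with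
  \<open>K - L\<close>, the right-hand side dominates \<open>(a + b) \<parallel>K - L\<parallel>\<^sup>2\<close> as soon as \<open>K \<ge> a I\<close> and \<open>L \<ge> b I\<close>
  (\<open>sqrt_lipschitz_coercive\<close>). The same inequality makes the root unique and shows that the
  remainder in the expansion of its trace is quadratic (\<open>trace_spd_sqrt_has_derivative\<close>). Existence
  of the root, and the bounds \<open>\<alpha>\<^sup>d \<le> det X \<le> \<beta>\<^sup>d\<close>, come from the spectral theorem, which is obtained by
  minimizing the Rayleigh quotient and splitting off eigenvectors.

  The entropy contributes \<open>- \<gamma> inv X\<close> in the Gaussian case, with Lipschitz constant \<open>\<gamma> / \<alpha>\<^sup>2\<close> by
  the resolvent identity. In the \<open>q\<close>-Gaussian case it contributes \<open>- \<gamma> m(q, d) (det X)\<^sup>p inv X\<close> with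
  \<open>p = (q - 1) / 2\<close>. If \<open>M\<close> bounds \<open>(det X)\<^sup>p\<close>, this has Lipschitz constant
  \<open>\<gamma> m(q, d) (M / \<alpha>\<^sup>2) (1 + \<bar>p\<bar> d)\<close> (\<open>det_powr_inverse_lipschitz\<close>): the summand \<open>1\<close> comes from varying the
  inverse and \<open>\<bar>p\<bar> d\<close> from varying the determinant. One may take \<open>M = \<beta>\<^bsup>pd\<^esup>\<close> for \<open>q > 1\<close> and \<open>M = \<alpha>\<^bsup>pd\<^esup>\<close> for
  \<open>q < 1\<close>.
\<close>

section \<open>Frobenius norm estimates\<close>

lemma transpose_add: "transpose (A + B) = transpose A + transpose B" for A B :: "real^'n^'m"
  by (simp add: transpose_def vec_eq_iff)

lemma transpose_diff: "transpose (A - B) = transpose A - transpose B" for A B :: "real^'n^'m"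
  by (simp add: transpose_def vec_eq_iff)

lemma frobenius_inner_transpose: "transpose A \<bullet> transpose B = A \<bullet> B" for A B :: "real^'d^'d"
proof -
  have "transpose A \<bullet> transpose B = (\<Sum>i\<in>UNIV. \<Sum>j\<in>UNIV. A$j$i * B$j$i)"
    by (simp add: inner_vec_def transpose_def)
  also have "\<dots> = (\<Sum>j\<in>UNIV. \<Sum>i\<in>UNIV. A$j$i * B$j$i)"
    by (rule sum.swap)
  finally show ?thesis
    by (simp add: inner_vec_def)
qed

lemma norm_transpose: "norm (transpose A) = norm A" for A :: "real^'d^'d"
  by (simp add: norm_eq_sqrt_inner frobenius_inner_transpose)

lemma frobenius_adjoint_left: "(A ** B) \<bullet> C = B \<bullet> (transpose A ** C)" for A B C :: "real^'d^'d"
  by (simp add: inner_matrix_eq_trace matrix_transpose_mul matrix_mul_assoc)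

lemma frobenius_adjoint_right: "(A ** B) \<bullet> C = A \<bullet> (C ** transpose B)" for A B C :: "real^'d^'d"
proof -
  have "(A ** B) \<bullet> C = (transpose B ** transpose A) \<bullet> transpose C"
    by (metis frobenius_inner_transpose matrix_transpose_mul)
  then show ?thesis
    by (metis frobenius_adjoint_left frobenius_inner_transpose matrix_transpose_mul transpose_transpose)
qed

lemma trace_eq_inner_mat1: "trace A = mat 1 \<bullet> A" for A :: "real^'d^'d"
  by (simp add: inner_matrix_eq_trace)

lemma column_matrix_mult: "column j (A ** B) = A *v column j B" for A B :: "real^'d^'d"
  by (simp add: column_def matrix_matrix_mult_def matrix_vector_mult_def vec_eq_iff)

lemma frobenius_inner_columns: "A \<bullet> B = (\<Sum>j\<in>UNIV. column j A \<bullet> column j B)" for A B :: "real^'d^'d"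
proof -
  have "A \<bullet> B = (\<Sum>i\<in>UNIV. \<Sum>j\<in>UNIV. A$i$j * B$i$j)"
    by (simp add: inner_vec_def)
  also have "\<dots> = (\<Sum>j\<in>UNIV. \<Sum>i\<in>UNIV. A$i$j * B$i$j)"
    by (rule sum.swap)
  finally show ?thesis
    by (simp add: inner_vec_def column_def)
qed

lemma norm_columns: "(norm A)\<^sup>2 = (\<Sum>j\<in>UNIV. (norm (column j A))\<^sup>2)" for A :: "real^'d^'d"
  by (simp add: power2_norm_eq_inner frobenius_inner_columns)

text \<open>
  The Frobenius norm is the Euclidean norm of the columns, and \<open>A\<close> acts on the columns of \<open>B\<close>
  separately, so only the operator bound \<open>c\<close> of \<open>A\<close> enters. Using \<open>norm A\<close> in place of \<open>c\<close> would
  bring dimension factors into the Lipschitz constants.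
\<close>

lemma norm_matrix_mult_left_le:
  fixes A B :: "real^'d^'d"
  assumes "\<And>v. norm (A *v v) \<le> c * norm v"
  shows "norm (A ** B) \<le> c * norm B"
proof -
  have c: "c \<ge> 0"
    using order_trans[OF norm_ge_zero assms[of "axis undefined 1"]] by simp
  have "(norm (A ** B))\<^sup>2 \<le> (\<Sum>j\<in>UNIV. (c * norm (column j B))\<^sup>2)"
    unfolding norm_columns column_matrix_mult by (intro sum_mono power_mono assms) auto
  also have "\<dots> = (c * norm B)\<^sup>2"
    by (simp add: power_mult_distrib norm_columns sum_distrib_left)
  finally show ?thesis
    by (rule power2_le_imp_le) (use c in auto)
qed

lemma norm_matrix_mult_right_le:
  fixes A B :: "real^'d^'d"
  assumes "transpose A = A" "\<And>v. norm (A *v v) \<le> c * norm v"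
  shows "norm (B ** A) \<le> c * norm B"
  using norm_matrix_mult_left_le[OF assms(2), of "transpose B"]
  by (metis assms(1) matrix_transpose_mul norm_transpose)

lemma norm_le_norm_matrix: "norm (A *v v) \<le> norm A * norm v" for A :: "real^'d^'d"
proof -
  have "(norm (A *v v))\<^sup>2 = (\<Sum>i\<in>UNIV. (A$i \<bullet> v)\<^sup>2)"
    unfolding power2_norm_eq_inner matrix_mult_dot
    by (subst inner_vec_def) (simp add: power2_eq_square)
  also have "\<dots> \<le> (\<Sum>i\<in>UNIV. (norm (A$i))\<^sup>2 * (norm v)\<^sup>2)"
    by (intro sum_mono) (metis Cauchy_Schwarz_ineq power2_norm_eq_inner)
  also have "\<dots> = (norm A * norm v)\<^sup>2"
    by (simp add: power_mult_distrib power2_norm_eq_inner inner_vec_def[of A A] sum_distrib_right)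
  finally show ?thesis
    by (rule power2_le_imp_le) auto
qed

text \<open>
  A lower bound \<open>K \<ge> c I\<close> passes to the operator \<open>E \<mapsto> K E\<close> on matrices, again column by column.
  With the companion for \<open>E \<mapsto> E K\<close> it bounds the Sylvester operator \<open>E \<mapsto> K E + E L\<close> below.
\<close>

lemma coercive_frobenius_left:
  fixes K E :: "real^'d^'d"
  assumes "\<And>v. c * (norm v)\<^sup>2 \<le> v \<bullet> (K *v v)"
  shows "c * (norm E)\<^sup>2 \<le> E \<bullet> (K ** E)"
  unfolding norm_columns frobenius_inner_columns column_matrix_mult sum_distrib_left
  by (intro sum_mono assms)

lemma coercive_frobenius_right:
  fixes K E :: "real^'d^'d"
  assumes "transpose K = K" "\<And>v. c * (norm v)\<^sup>2 \<le> v \<bullet> (K *v v)"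
  shows "c * (norm E)\<^sup>2 \<le> E \<bullet> (E ** K)"
  using coercive_frobenius_left[OF assms(2), of "transpose E"]
  by (metis assms(1) frobenius_inner_transpose matrix_transpose_mul norm_transpose)

lemma symmetric_inner_swap:
  "transpose A = A \<Longrightarrow> (A *v x) \<bullet> y = x \<bullet> (A *v y)" for A :: "real^'d^'d"
  by (metis dot_lmul_matrix transpose_matrix_vector)

section \<open>The spectral theorem\<close>

text \<open>
  First-order optimality: at a minimum the linear term of a quadratic polynomial vanishes.
\<close>

lemma linear_coefficient_zero_if_nonneg:
  fixes a b :: real
  assumes "\<And>t. 0 \<le> 2 * t * a + t\<^sup>2 * b"
  shows "a = 0"
proof (rule ccontr)
  assume a: "a \<noteq> 0"
  \<comment> \<open>at \<open>t = - s\<close> the linear term outweighs the quadratic one\<close>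
  define s where "s = a / (\<bar>b\<bar> + 1)"
  have p: "\<bar>b\<bar> + 1 > 0" by simp
  have "0 \<le> 2 * (-s) * a + (-s)\<^sup>2 * b" by (rule assms)
  also have "\<dots> \<le> - 2 * s * a + s\<^sup>2 * (\<bar>b\<bar> + 1)"
    by (simp add: mult_left_mono)
  also have "\<dots> = - a\<^sup>2 / (\<bar>b\<bar> + 1)"
    unfolding s_def using p by (simp add: power2_eq_square divide_simps del: abs_add_one_gt_zero)
  also have "\<dots> < 0" using a p by (simp add: divide_neg_pos)
  finally show False by simp
qed

text \<open>
  The eigenvector is a minimizer \<open>u\<close> of the Rayleigh quotient on the unit sphere of \<open>S\<close>, which is
  compact. The quadratic form \<open>v \<bullet> f v - c (norm v)\<^sup>2\<close> is nonnegative on \<open>S\<close> and zero at \<open>u\<close>; moving from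
  \<open>u\<close> in the direction \<open>w = f u - c u\<close>, its linear term is a multiple of \<open>w \<bullet> w\<close>, so \<open>w = 0\<close>. The
  minimality of \<open>c\<close> is kept in the conclusion because it converts positivity into coercivity.
\<close>

lemma selfadjoint_min_eigenvector:
  fixes f :: "'a::euclidean_space \<Rightarrow> 'a"
  assumes lin: "linear f" and sa: "\<And>x y. f x \<bullet> y = x \<bullet> f y"
    and S: "subspace S" "f ` S \<subseteq> S" "S \<noteq> {0}"
  obtains u c where "u \<in> S" "norm u = 1" "f u = c *\<^sub>R u" "\<And>v. v \<in> S \<Longrightarrow> c * (norm v)\<^sup>2 \<le> v \<bullet> f v"
proof -
  let ?K = "S \<inter> sphere 0 1"
  obtain w where w: "w \<in> S" "w \<noteq> 0" using S subspace_0 by fastforce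
  have "(1 / norm w) *\<^sub>R w \<in> ?K" using w S(1) by (auto simp: subspace_scale)
  then have ne: "?K \<noteq> {}" by blast
  have cpt: "compact ?K"
    using closed_subspace[OF S(1)] by (metis compact_Int_closed compact_sphere inf_commute)
  have cont: "continuous_on ?K (\<lambda>x. x \<bullet> f x)"
    by (intro continuous_intros linear_continuous_on linear_conv_bounded_linear[THEN iffD1] lin)
  obtain u where u: "u \<in> S" "norm u = 1" and min: "\<And>y. y \<in> ?K \<Longrightarrow> u \<bullet> f u \<le> y \<bullet> f y"
    using continuous_attains_inf[OF cpt ne cont] by auto
  define c where "c = u \<bullet> f u"
  have ray: "c * (norm v)\<^sup>2 \<le> v \<bullet> f v" if v: "v \<in> S" for v
  proof (cases "v = 0")
    case False
    have "(1 / norm v) *\<^sub>R v \<in> ?K" using v False S(1) by (auto simp: subspace_scale)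
    from min[OF this] have "c \<le> (v \<bullet> f v) / (norm v)\<^sup>2"
      by (simp add: c_def linear_scale[OF lin] power2_eq_square)
    then show ?thesis using False by (simp add: field_simps)
  qed (simp add: linear_0[OF lin])
  define w where "w = f u - c *\<^sub>R u"
  have wS: "w \<in> S" unfolding w_def using u S by (auto intro!: subspace_diff subspace_scale)
  have uu: "u \<bullet> u = 1" using u by (simp add: norm_eq_1)
  have "0 \<le> 2 * t * (w \<bullet> w) + t\<^sup>2 * (w \<bullet> f w - c * (w \<bullet> w))" for t
  proof -
    have "0 \<le> (u + t *\<^sub>R w) \<bullet> f (u + t *\<^sub>R w) - c * (norm (u + t *\<^sub>R w))\<^sup>2"
      using ray[of "u + t *\<^sub>R w"] u wS S(1) by (auto simp: subspace_add subspace_scale)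
    also have "\<dots> = (u \<bullet> f u - c * (u \<bullet> u)) + t * (u \<bullet> f w + w \<bullet> f u - 2 * c * (u \<bullet> w))
        + t\<^sup>2 * (w \<bullet> f w - c * (w \<bullet> w))"
      unfolding power2_norm_eq_inner
      by (simp add: linear_add[OF lin] linear_scale[OF lin] inner_simps
          inner_commute power2_eq_square algebra_simps)
    also have "u \<bullet> f u - c * (u \<bullet> u) = 0" using uu by (simp add: c_def)
    also have "u \<bullet> f w = f u \<bullet> w" using sa by simp
    also have "f u \<bullet> w + w \<bullet> f u - 2 * c * (u \<bullet> w) = 2 * (w \<bullet> w)"
      by (simp add: w_def inner_simps inner_commute algebra_simps)
    finally show ?thesis by (simp add: algebra_simps)
  qed
  then have "w \<bullet> w = 0" by (rule linear_coefficient_zero_if_nonneg)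
  then have "f u = c *\<^sub>R u" by (simp add: w_def)
  with u ray that show ?thesis by blast
qed

text \<open>
  The orthogonal complement of an eigenvector within \<open>S\<close> is again invariant and of smaller dimension.
\<close>

lemma selfadjoint_eigenbasis_subspace:
  fixes f :: "'a::euclidean_space \<Rightarrow> 'a"
  assumes lin: "linear f" and sa: "\<And>x y. f x \<bullet> y = x \<bullet> f y"
    and S: "subspace S" "f ` S \<subseteq> S"
  shows "\<exists>B. pairwise orthogonal B \<and> (\<forall>b\<in>B. norm b = 1 \<and> (\<exists>c. f b = c *\<^sub>R b)) \<and> span B = S"
  using S
proof (induction "dim S" arbitrary: S rule: less_induct)
  case less
  show ?case
  proof (cases "S = {0}")
    case True
    then show ?thesis by (intro exI[of _ "{}"]) auto
  next
    case False
    obtain u c where u: "u \<in> S" "norm u = 1" "f u = c *\<^sub>R u"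
      using selfadjoint_min_eigenvector[OF lin sa less.prems False] by blast
    define T where "T = S \<inter> {x. u \<bullet> x = 0}"
    have T: "subspace T"
      unfolding T_def using less.prems(1) by (intro subspace_inter subspace_hyperplane)
    have fT: "f ` T \<subseteq> T"
    proof safe
      fix x assume x: "x \<in> T"
      have "u \<bullet> f x = c * (u \<bullet> x)" using sa[of u x] u(3) by simp
      with x less.prems(2) show "f x \<in> T" by (auto simp: T_def)
    qed
    have "u \<notin> T" using u(2) by (auto simp: T_def)
    moreover have "T \<subseteq> S" by (simp add: T_def)
    ultimately have "span T \<subset> span S"
      using u(1) T less.prems(1) by (metis psubsetI span_eq_iff)
    then have "dim T < dim S" by (rule dim_psubset)
    from less.hyps[OF this T fT] obtain B where B: "pairwise orthogonal B"
      "\<forall>b\<in>B. norm b = 1 \<and> (\<exists>c. f b = c *\<^sub>R b)" "span B = T" by blast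
    have BT: "B \<subseteq> T" using B(3) span_superset by blast
    have "pairwise orthogonal (insert u B)"
      using B(1) BT by (auto simp: pairwise_insert orthogonal_def T_def inner_commute)
    moreover have "\<forall>b\<in>insert u B. norm b = 1 \<and> (\<exists>c. f b = c *\<^sub>R b)" using B(2) u by auto
    moreover have "span (insert u B) = S"
    proof
      have "insert u B \<subseteq> S" using u(1) BT by (auto simp: T_def)
      then show "span (insert u B) \<subseteq> S" using less.prems(1) by (rule span_minimal)
      show "S \<subseteq> span (insert u B)"
      proof
        fix x assume x: "x \<in> S"
        have "u \<bullet> u = 1" using u by (simp add: norm_eq_1)
        then have "x - (u \<bullet> x) *\<^sub>R u \<in> T"
          using x u(1) less.prems(1) by (auto simp: T_def subspace_diff subspace_scale inner_simps)
        then show "x \<in> span (insert u B)" using B(3) by (auto simp: span_insert)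
      qed
    qed
    ultimately show ?thesis by blast
  qed
qed

definition diag_matrix :: "('d \<Rightarrow> real) \<Rightarrow> real^'d^'d" where
  "diag_matrix D = (\<chi> i j. if i = j then D i else 0)"

text \<open>
  The orthonormal eigenbasis, indexed by the coordinates, supplies the columns of \<open>P\<close>.
\<close>

lemma symmetric_orthogonal_diagonalization:
  fixes X :: "real^'d^'d"
  assumes X: "transpose X = X"
  obtains P D where "orthogonal_matrix P" "X = P ** diag_matrix D ** transpose P"
    "\<And>i. X *v column i P = D i *\<^sub>R column i P" "\<And>i. norm (column i P) = 1"
proof -
  obtain B where B: "pairwise orthogonal B"
      "\<forall>b\<in>B. norm b = 1 \<and> (\<exists>c. X *v b = c *\<^sub>R b)" "span B = UNIV"
    using selfadjoint_eigenbasis_subspace[of "(*v) X" UNIV] symmetric_inner_swap[OF X] by auto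
  have indep: "independent B"
    using B(1,2) by (intro pairwise_orthogonal_independent) auto
  \<comment> \<open>numbering the basis by the index type turns it into a square matrix\<close>
  have "card B = CARD('d)"
    using dim_eq_card[OF _ indep, of UNIV] B(3) by (simp add: dim_UNIV)
  moreover have "finite B" using indep by (rule finiteI_independent)
  ultimately obtain b where b: "bij_betw b (UNIV :: 'd set) B"
    by (metis finite_same_card_bij finite)
  define P :: "real^'d^'d" where "P = (\<chi> i j. b j $ i)"
  have col: "column j P = b j" for j by (simp add: P_def column_def vec_eq_iff)
  have bB: "b j \<in> B" for j using b by (auto simp: bij_betw_def)
  have inj: "b i = b j \<longleftrightarrow> i = j" for i j using b by (auto simp: bij_betw_def inj_on_def)
  define D where "D i = (SOME c. X *v b i = c *\<^sub>R b i)" for i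
  have D: "X *v b i = D i *\<^sub>R b i" for i
    unfolding D_def using B(2) bB by (metis (mono_tags, lifting) someI_ex)
  have orth: "orthogonal_matrix P"
    unfolding orthogonal_matrix_orthonormal_columns col
    using B(1,2) bB inj by (auto simp: pairwise_def)
  have "column j (X ** P) = column j (P ** diag_matrix D)" for j
  proof -
    have "column j (P ** diag_matrix D) = D j *\<^sub>R column j P"
      by (simp add: column_def diag_matrix_def matrix_matrix_mult_def vec_eq_iff if_distrib
          mult.commute cong: if_cong)
    then show ?thesis by (simp add: column_matrix_mult col D)
  qed
  then have XP: "X ** P = P ** diag_matrix D"
    by (simp add: column_def vec_eq_iff)
  have "X = X ** (P ** transpose P)" using orth by (simp add: orthogonal_matrix_def)
  also have "\<dots> = P ** diag_matrix D ** transpose P" by (simp add: matrix_mul_assoc XP)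
  finally show ?thesis using that orth D bB B(2) by (simp add: col)
qed

section \<open>Coercivity\<close>

lemma matrix_left_diff_distrib: "(A - B) ** C = A ** C - B ** C" for A B C :: "real^'d^'d"
  by (simp add: matrix_matrix_mult_def vec_eq_iff left_diff_distrib sum_subtractf)

lemma matrix_right_diff_distrib: "A ** (B - C) = A ** B - A ** C" for A B C :: "real^'d^'d"
  by (simp add: matrix_matrix_mult_def vec_eq_iff right_diff_distrib sum_subtractf)

lemma spd_symmetric: "spd X \<Longrightarrow> transpose X = X"
  by (simp add: spd_def sym_matrices_def)

text \<open>
  The smallest eigenvalue serves as \<open>c\<close>.
\<close>

lemma spd_coercive:
  fixes X :: "real^'d^'d"
  assumes "spd X"
  obtains c where "c > 0" "\<And>v. c * (norm v)\<^sup>2 \<le> v \<bullet> (X *v v)"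
proof -
  obtain u c where u: "norm u = 1" "X *v u = c *\<^sub>R u" "\<And>v. c * (norm v)\<^sup>2 \<le> v \<bullet> (X *v v)"
    by (rule selfadjoint_min_eigenvector[of "(*v) X" UNIV])
      (auto simp: symmetric_inner_swap[OF spd_symmetric[OF assms]] UNIV_not_singleton)
  have "u \<bullet> u = 1" using u(1) by (simp add: norm_eq_1)
  moreover from this have "0 < u \<bullet> (X *v u)"
    using assms unfolding spd_def by (metis inner_zero_left zero_neq_one)
  ultimately have "c > 0" by (simp add: u(2))
  with u(3) that show ?thesis by blast
qed

lemma spd_if_coercive:
  fixes X :: "real^'d^'d"
  assumes "transpose X = X" "c > 0" "\<And>v. c * (norm v)\<^sup>2 \<le> v \<bullet> (X *v v)"
  shows "spd X"
  unfolding spd_def sym_matrices_def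
proof (intro conjI allI impI)
  fix v :: "real^'d" assume "v \<noteq> 0"
  then have "0 < c * (norm v)\<^sup>2" using assms(2) by simp
  then show "0 < v \<bullet> (X *v v)" using assms(3) by (rule less_le_trans)
qed (simp add: assms(1))

text \<open>
  Openness of the positive definite matrices among the symmetric ones, as needed for derivatives within
  the space of symmetric matrices.
\<close>

lemma spd_perturb:
  fixes M H :: "real^'d^'d"
  assumes "transpose M = M" "transpose H = H" "\<And>v. c * (norm v)\<^sup>2 \<le> v \<bullet> (M *v v)" "norm H < c"
  shows "spd (M + H)"
proof (rule spd_if_coercive)
  show "transpose (M + H) = M + H" using assms(1,2) by (simp add: transpose_add)
  show "c - norm H > 0" using assms(4) by simp
  fix v :: "real^'d"
  have "\<bar>v \<bullet> (H *v v)\<bar> \<le> norm v * norm (H *v v)" by (rule Cauchy_Schwarz_ineq2)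
  also have "\<dots> \<le> norm v * (norm H * norm v)"
    by (intro mult_left_mono norm_le_norm_matrix) auto
  finally have "- (norm H * (norm v)\<^sup>2) \<le> v \<bullet> (H *v v)" by (simp add: power2_eq_square algebra_simps)
  with assms(3)[of v] show "(c - norm H) * (norm v)\<^sup>2 \<le> v \<bullet> ((M + H) *v v)"
    by (simp add: algebra_simps inner_simps)
qed

section \<open>Square roots of positive definite matrices\<close>

lemma diag_matrix_mult: "diag_matrix D ** diag_matrix E = diag_matrix (\<lambda>i. D i * E i)"
proof -
  have "(\<Sum>k\<in>UNIV. (if i = k then D i else 0) * (if k = j then E k else 0))
      = (\<Sum>k\<in>UNIV. if k = i then (if i = j then D i * E i else 0) else 0)" for i j
    by (rule sum.cong) auto
  then show ?thesis
    by (simp add: diag_matrix_def matrix_matrix_mult_def vec_eq_iff)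
qed

lemma inner_diag_matrix: "v \<bullet> (diag_matrix D *v v) = (\<Sum>i\<in>UNIV. D i * (v$i)\<^sup>2)"
proof -
  have "(diag_matrix D *v v) $ i = D i * v $ i" for i
  proof -
    have "(diag_matrix D *v v) $ i = (\<Sum>j\<in>UNIV. (if i = j then D i else 0) * v $ j)"
      by (simp add: diag_matrix_def matrix_vector_mult_def)
    also have "\<dots> = (\<Sum>j\<in>UNIV. if j = i then D i * v $ i else 0)"
      by (rule sum.cong) auto
    finally show ?thesis by simp
  qed
  then show ?thesis
    by (simp add: inner_vec_def power2_eq_square ac_simps)
qed

lemma spd_sqrt_exists:
  fixes X :: "real^'d^'d"
  assumes "spd X"
  shows "\<exists>R. spd R \<and> R ** R = X"
proof -
  obtain P D where P: "orthogonal_matrix P" and X: "X = P ** diag_matrix D ** transpose P"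
    and ev: "\<And>i. X *v column i P = D i *\<^sub>R column i P" "\<And>i. norm (column i P) = 1"
    using symmetric_orthogonal_diagonalization[OF spd_symmetric[OF assms]] by metis
  have PP: "transpose P ** P = mat 1" "P ** transpose P = mat 1"
    using P by (auto simp: orthogonal_matrix_def)
  have D: "D i > 0" for i
  proof -
    have "column i P \<bullet> column i P = 1" using ev(2)[of i] by (simp add: norm_eq_1)
    moreover from this have "0 < column i P \<bullet> (X *v column i P)"
      using assms unfolding spd_def by (metis inner_zero_left zero_neq_one)
    ultimately show ?thesis by (simp add: ev)
  qed
  define R where "R = P ** diag_matrix (\<lambda>i. sqrt (D i)) ** transpose P"
  have "R ** R = P ** diag_matrix (\<lambda>i. sqrt (D i)) ** (transpose P ** P)
      ** diag_matrix (\<lambda>i. sqrt (D i)) ** transpose P"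
    unfolding R_def by (simp only: matrix_mul_assoc)
  also have "\<dots> = P ** (diag_matrix (\<lambda>i. sqrt (D i)) ** diag_matrix (\<lambda>i. sqrt (D i))) ** transpose P"
    by (simp only: PP matrix_mul_rid matrix_mul_assoc)
  also have "\<dots> = X"
    using D by (simp add: X diag_matrix_mult less_imp_le)
  finally have RR: "R ** R = X" .
  have "spd R"
    unfolding spd_def sym_matrices_def mem_Collect_eq
  proof (intro conjI allI impI)
    have "transpose (diag_matrix E) = diag_matrix E" for E :: "'d \<Rightarrow> real"
      by (auto simp: diag_matrix_def transpose_def vec_eq_iff)
    then show "transpose R = R"
      by (simp add: R_def matrix_transpose_mul matrix_mul_assoc)
    fix v :: "real^'d" assume v: "v \<noteq> 0"
    define w where "w = transpose P *v v"
    have "P *v w = v" using PP by (simp add: w_def matrix_vector_mul_assoc del: transpose_matrix_vector)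
    then have "w \<noteq> 0" using v by auto
    then obtain i where i: "w $ i \<noteq> 0" by (auto simp: vec_eq_iff)
    have "R *v v = P *v (diag_matrix (\<lambda>i. sqrt (D i)) *v w)"
      by (simp add: R_def w_def matrix_vector_mul_assoc matrix_mul_assoc del: transpose_matrix_vector)
    then have "v \<bullet> (R *v v) = w \<bullet> (diag_matrix (\<lambda>i. sqrt (D i)) *v w)"
      by (simp add: w_def dot_lmul_matrix)
    also have "\<dots> > 0"
      unfolding inner_diag_matrix
      by (rule sum_pos2[of _ i]) (use D i in \<open>auto simp: less_imp_le\<close>)
    finally show "0 < v \<bullet> (R *v v)" .
  qed
  with RR show ?thesis by blast
qed

text \<open>
  With \<open>E = K - L\<close> one has \<open>K\<^sup>2 - L\<^sup>2 = K E + E L\<close>, and pairing this with \<open>E\<close> gives at least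
  \<open>(a + b) (norm E)\<^sup>2\<close>. This single estimate yields the uniqueness of the square root, its
  Lipschitz constant \<open>1 / (2 \<alpha>)\<close> (both bounds at least \<open>\<alpha>\<close>), and, with \<open>b = 0\<close>, the control
  needed to differentiate its trace.
\<close>

lemma sqrt_lipschitz_coercive:
  fixes K L :: "real^'d^'d"
  assumes "transpose L = L"
    and K: "\<And>v. a * (norm v)\<^sup>2 \<le> v \<bullet> (K *v v)" and L: "\<And>v. b * (norm v)\<^sup>2 \<le> v \<bullet> (L *v v)"
  shows "(a + b) * norm (K - L) \<le> norm (K ** K - L ** L)"
proof -
  define E where "E = K - L"
  have "K ** K - L ** L = K ** E + E ** L"
    by (simp add: E_def matrix_left_diff_distrib matrix_right_diff_distrib)
  then have "(a + b) * (norm E)\<^sup>2 \<le> E \<bullet> (K ** K - L ** L)"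
    using coercive_frobenius_left[OF K, of E] coercive_frobenius_right[OF assms(1) L, of E]
    by (simp add: inner_add_right algebra_simps)
  also have "\<dots> \<le> norm E * norm (K ** K - L ** L)" by (rule norm_cauchy_schwarz)
  finally show ?thesis
    unfolding E_def[symmetric] by (cases "E = 0") (simp_all add: power2_eq_square)
qed

lemma spd_sqrt_unique:
  fixes R T :: "real^'d^'d"
  assumes "spd R" "spd T" "R ** R = T ** T"
  shows "R = T"
proof -
  obtain a where a: "a > 0" "\<And>v. a * (norm v)\<^sup>2 \<le> v \<bullet> (R *v v)" using spd_coercive[OF assms(1)] by blast
  obtain b where b: "b > 0" "\<And>v. b * (norm v)\<^sup>2 \<le> v \<bullet> (T *v v)" using spd_coercive[OF assms(2)] by blast
  have "(a + b) * norm (R - T) \<le> 0"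
    using sqrt_lipschitz_coercive[OF spd_symmetric[OF assms(2)] a(2) b(2)] assms(3) by simp
  with a(1) b(1) show ?thesis by (simp add: mult_le_0_iff)
qed

lemma spd_spd_sqrt: "spd X \<Longrightarrow> spd (spd_sqrt X)"
  and spd_sqrt_square: "spd X \<Longrightarrow> spd_sqrt X ** spd_sqrt X = X"
proof -
  assume "spd X"
  then have "\<exists>!R. spd R \<and> R ** R = X"
    using spd_sqrt_exists spd_sqrt_unique by metis
  from theI'[OF this] show "spd (spd_sqrt X)" "spd_sqrt X ** spd_sqrt X = X"
    by (simp_all add: spd_sqrt_def)
qed

text \<open>
  The square root is operator monotone against multiples of the identity: evaluated at a unit
  eigenvector for the smallest eigenvalue \<open>c\<close> of \<open>K\<close>, the hypothesis reads \<open>a\<^sup>2 \<le> c\<^sup>2\<close>.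
\<close>

lemma coercive_of_square:
  fixes K :: "real^'d^'d"
  assumes K: "spd K" and sq: "\<And>v. a\<^sup>2 * (norm v)\<^sup>2 \<le> v \<bullet> ((K ** K) *v v)"
  shows "a * (norm v)\<^sup>2 \<le> v \<bullet> (K *v v)"
proof -
  obtain u c where u: "norm u = 1" "K *v u = c *\<^sub>R u" "\<And>v. c * (norm v)\<^sup>2 \<le> v \<bullet> (K *v v)"
    by (rule selfadjoint_min_eigenvector[of "(*v) K" UNIV])
      (auto simp: symmetric_inner_swap[OF spd_symmetric[OF K]] UNIV_not_singleton)
  have uu: "u \<bullet> u = 1" using u(1) by (simp add: norm_eq_1)
  then have "0 < u \<bullet> (K *v u)"
    using K unfolding spd_def by (metis inner_zero_left zero_neq_one)
  then have "c > 0" using uu by (simp add: u(2))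
  have "(K ** K) *v u = c\<^sup>2 *\<^sub>R u"
    by (simp add: matrix_vector_mul_assoc[symmetric] u(2) matrix_vector_mult_scaleR power2_eq_square)
  with sq[of u] have "a\<^sup>2 \<le> c\<^sup>2" using u(1) uu by simp
  then have "a \<le> c" by (rule power2_le_imp_le) (use \<open>c > 0\<close> in simp)
  then show ?thesis using u(3)[of v] mult_right_mono[of a c "(norm v)\<^sup>2"] by simp
qed

section \<open>Inverses\<close>

lemma matrix_inv_spd:
  fixes X :: "real^'d^'d"
  assumes "spd X"
  shows "matrix_inv X ** X = mat 1" "X ** matrix_inv X = mat 1"
proof -
  have "X *v v \<noteq> 0" if "v \<noteq> 0" for v
    using assms that unfolding spd_def by (metis inner_zero_right less_irrefl)
  then obtain B where "B ** X = mat 1"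
    using matrix_left_invertible_ker[of X] by blast
  then have "\<exists>A'. X ** A' = mat 1 \<and> A' ** X = mat 1"
    using matrix_left_right_inverse by blast
  from someI_ex[OF this] show "matrix_inv X ** X = mat 1" "X ** matrix_inv X = mat 1"
    by (simp_all add: matrix_inv_def)
qed

lemma matrix_inv_symmetric:
  fixes X :: "real^'d^'d"
  assumes "spd X"
  shows "transpose (matrix_inv X) = matrix_inv X"
proof -
  have "transpose (matrix_inv X) ** X = mat 1"
    using arg_cong[OF matrix_inv_spd(2)[OF assms], of transpose] spd_symmetric[OF assms]
    by (simp add: matrix_transpose_mul)
  then show ?thesis
    by (metis matrix_inv_spd(2)[OF assms] matrix_mul_assoc matrix_mul_lid matrix_mul_rid)
qed

lemma norm_matrix_inv_mult_le:
  fixes X :: "real^'d^'d"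
  assumes "spd X" "a > 0" "\<And>v. a * (norm v)\<^sup>2 \<le> v \<bullet> (X *v v)"
  shows "norm (matrix_inv X *v v) \<le> (1 / a) * norm v"
proof -
  define w where "w = matrix_inv X *v v"
  have "X *v w = v" by (simp add: w_def matrix_vector_mul_assoc matrix_inv_spd[OF assms(1)])
  then have "a * (norm w)\<^sup>2 \<le> w \<bullet> v" using assms(3)[of w] by simp
  also have "\<dots> \<le> norm w * norm v" by (rule norm_cauchy_schwarz)
  finally have "a * norm w \<le> norm v"
    by (cases "w = 0") (simp_all add: power2_eq_square)
  then show ?thesis using assms(2) by (simp add: w_def field_simps)
qed

text \<open>
  The factor \<open>sqrt d\<close> is the Frobenius norm of the identity.
\<close>

lemma norm_matrix_inv_le:
  fixes X :: "real^'d^'d"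
  assumes "spd X" "a > 0" "\<And>v. a * (norm v)\<^sup>2 \<le> v \<bullet> (X *v v)"
  shows "norm (matrix_inv X) \<le> sqrt (real CARD('d)) / a"
proof -
  have "(norm (mat 1 :: real^'d^'d))\<^sup>2 = real CARD('d)"
    by (simp add: power2_norm_eq_inner trace_eq_inner_mat1[symmetric] trace_I)
  then have "norm (mat 1 :: real^'d^'d) = sqrt (real CARD('d))"
    by (metis norm_ge_zero real_sqrt_unique)
  then show ?thesis
    using norm_matrix_mult_left_le[OF norm_matrix_inv_mult_le[OF assms], of "mat 1"] by simp
qed

text \<open>
  Resolvent identity \<open>inv X - inv Y = inv X (Y - X) inv Y\<close>.
\<close>

lemma norm_matrix_inv_diff_le:
  fixes X Y :: "real^'d^'d"
  assumes X: "spd X" "\<And>v. a * (norm v)\<^sup>2 \<le> v \<bullet> (X *v v)"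
    and Y: "spd Y" "\<And>v. a * (norm v)\<^sup>2 \<le> v \<bullet> (Y *v v)" and a: "a > 0"
  shows "norm (matrix_inv X - matrix_inv Y) \<le> norm (X - Y) / a\<^sup>2"
proof -
  have "matrix_inv X - matrix_inv Y = matrix_inv X ** (Y - X) ** matrix_inv Y"
  proof -
    have "matrix_inv X ** (Y - X) ** matrix_inv Y
        = matrix_inv X ** (Y ** matrix_inv Y) - (matrix_inv X ** X) ** matrix_inv Y"
      by (simp only: matrix_left_diff_distrib matrix_right_diff_distrib matrix_mul_assoc)
    then show ?thesis by (simp add: matrix_inv_spd X Y)
  qed
  also have "norm \<dots> \<le> (1 / a) * norm (matrix_inv X ** (Y - X))"
    by (rule norm_matrix_mult_right_le[OF matrix_inv_symmetric[OF Y(1)]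
          norm_matrix_inv_mult_le[OF Y(1) a Y(2)]])
  also have "\<dots> \<le> (1 / a) * ((1 / a) * norm (Y - X))"
    using a by (intro mult_left_mono norm_matrix_mult_left_le norm_matrix_inv_mult_le X) auto
  also have "\<dots> = norm (X - Y) / a\<^sup>2"
    by (simp add: power2_eq_square norm_minus_commute)
  finally show ?thesis .
qed

section \<open>Derivatives of the determinant and of the trace of the square root\<close>

text \<open>
  Differentiating the Leibniz formula at the identity, each summand keeps a product of all but one
  of the factors \<open>\<delta>\<^bsub>j, p j\<^esub>\<close>. It is nonzero only if \<open>p\<close> fixes all points but one, hence all points.
\<close>

text \<open>
  Jacobi's formula, reduced to the identity matrix through \<open>det Z = det X * det (inv X ** Z)\<close>.
\<close>

lemma det_has_derivative_at_mat1:
  "(det has_derivative trace) (at (mat 1 :: real^'d^'d))"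
proof -
  let ?Perm = "{p. p permutes (UNIV :: 'd set)}"
  have coord: "((\<lambda>A :: real^'d^'d. A $ i $ j) has_derivative (\<lambda>H. H $ i $ j)) (at (mat 1))" for i j
    by (intro bounded_linear_imp_has_derivative bounded_linear_compose[OF bounded_linear_vec_nth bounded_linear_vec_nth])
  have "(det has_derivative (\<lambda>H. \<Sum>p\<in>?Perm. of_int (sign p) *
      (\<Sum>i\<in>UNIV. H $ i $ p i * (\<Prod>j\<in>UNIV - {i}. (mat 1 :: real^'d^'d) $ j $ p j)))) (at (mat 1))"
    unfolding det_def[abs_def]
    by (intro has_derivative_sum has_derivative_mult_right has_derivative_prod coord)
  moreover have "(\<Sum>p\<in>?Perm. of_int (sign p) *
      (\<Sum>i\<in>UNIV. H $ i $ p i * (\<Prod>j\<in>UNIV - {i}. (mat 1 :: real^'d^'d) $ j $ p j))) = trace H"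
      for H :: "real^'d^'d"
  proof -
    have zero: "(\<Prod>j\<in>UNIV - {i}. (mat 1 :: real^'d^'d) $ j $ p j) = 0"
      if p: "p permutes UNIV" "p \<noteq> id" for p :: "'d \<Rightarrow> 'd" and i
    proof -
      have "\<exists>j. j \<noteq> i \<and> p j \<noteq> j"
      proof (rule ccontr)
        assume "\<not> ?thesis"
        then have fixed: "\<And>j. j \<noteq> i \<Longrightarrow> p j = j" by blast
        have "inj p" using p(1) by (rule permutes_inj)
        then have "p i = i" using fixed by (metis injD)
        with fixed have "p = id" by (metis eq_id_iff)
        with p(2) show False by simp
      qed
      then obtain j where "j \<noteq> i" "p j \<noteq> j" by blast
      then show ?thesis by (intro prod_zero) (auto simp: mat_def intro!: bexI[of _ j])
    qed
    have "(\<Sum>p\<in>?Perm. of_int (sign p) *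
        (\<Sum>i\<in>UNIV. H $ i $ p i * (\<Prod>j\<in>UNIV - {i}. (mat 1 :: real^'d^'d) $ j $ p j)))
      = (\<Sum>p\<in>{id}. of_int (sign p) *
        (\<Sum>i\<in>UNIV. H $ i $ p i * (\<Prod>j\<in>UNIV - {i}. (mat 1 :: real^'d^'d) $ j $ p j)))"
      by (rule sum.mono_neutral_right) (auto simp: finite_permutations permutes_id zero)
    also have "\<dots> = trace H"
      by (simp add: trace_def mat_def sign_id)
    finally show ?thesis .
  qed
  ultimately show ?thesis by (simp add: fun_eq_iff[symmetric])
qed

lemma bounded_linear_matrix_mult_left: "bounded_linear (\<lambda>X. A ** X)" for A :: "real^'d^'d"
  unfolding linear_conv_bounded_linear[symmetric]
  by (rule linearI) (simp_all add: matrix_add_ldistrib matrix_scalar_ac scalar_matrix_assoc)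

lemma bounded_linear_matrix_mult_right: "bounded_linear (\<lambda>X. X ** A)" for A :: "real^'d^'d"
  unfolding linear_conv_bounded_linear[symmetric]
  by (rule linearI)
    (simp_all add: matrix_matrix_mult_def vec_eq_iff distrib_right sum.distrib sum_distrib_left mult.assoc)

lemma det_has_derivative:
  fixes X :: "real^'d^'d"
  assumes "spd X"
  shows "(det has_derivative (\<lambda>H. (det X *\<^sub>R matrix_inv X) \<bullet> H)) (at X within T)"
proof -
  note inv = matrix_inv_spd[OF assms]
  have "(det has_derivative trace) (at (matrix_inv X ** X))"
    unfolding inv by (rule det_has_derivative_at_mat1)
  then have "((\<lambda>Z. det X * det (matrix_inv X ** Z)) has_derivative (\<lambda>H. det X * trace (matrix_inv X ** H))) (at X within T)"
    by (intro has_derivative_mult_right has_derivative_compose[of "\<lambda>Z. matrix_inv X ** Z" _ _ _ det]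
        bounded_linear_imp_has_derivative bounded_linear_matrix_mult_left)
  moreover have "det X * det (matrix_inv X ** Z) = det Z" for Z
    by (metis det_mul inv(2) matrix_mul_assoc matrix_mul_lid)
  moreover have "trace (matrix_inv X ** H) = matrix_inv X \<bullet> H" for H
    by (simp add: inner_matrix_eq_trace matrix_inv_symmetric[OF assms])
  ultimately show ?thesis by simp
qed

lemma has_derivative_quadratic_remainder:
  fixes f :: "'a::real_normed_vector \<Rightarrow> 'b::real_normed_vector"
  assumes "bounded_linear f'" and "\<delta> > 0"
    and rem: "\<And>y. y \<in> S \<Longrightarrow> norm (y - x) < \<delta> \<Longrightarrow> norm (f y - f x - f' (y - x)) \<le> C * (norm (y - x))\<^sup>2"
  shows "(f has_derivative f') (at x within S)"
  unfolding has_derivative_within_alt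
proof (intro conjI allI impI)
  fix e :: real assume e: "0 < e"
  let ?d = "min \<delta> (e / (\<bar>C\<bar> + 1))"
  have "norm (f y - f x - f' (y - x)) \<le> e * norm (y - x)" if y: "y \<in> S" "norm (y - x) < ?d" for y
  proof -
    have "norm (f y - f x - f' (y - x)) \<le> C * (norm (y - x))\<^sup>2" using rem y by simp
    also have "\<dots> \<le> (\<bar>C\<bar> + 1) * norm (y - x) * norm (y - x)"
      unfolding power2_eq_square mult.assoc by (intro mult_right_mono) auto
    also have "\<dots> \<le> e * norm (y - x)"
      using y(2) by (intro mult_right_mono) (simp_all add: pos_less_divide_eq mult.commute)
    finally show ?thesis .
  qed
  then show "\<exists>d>0. \<forall>y\<in>S. norm (y - x) < d \<longrightarrow> norm (f y - f x - f' (y - x)) \<le> e * norm (y - x)"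
    using e \<open>\<delta> > 0\<close> by (intro exI[of _ ?d]) auto
qed (rule assms(1))

text \<open>
  Let \<open>K\<close> and \<open>K + E\<close> be the square roots of \<open>M\<close> and \<open>N = M + H\<close>. From \<open>H = K E + E K + E\<^sup>2\<close>, pairing with
  \<open>inv K\<close> gives \<open>inv K \<bullet> H = 2 trace E + inv K \<bullet> E\<^sup>2\<close>. The last term is of second order since
  \<open>norm E\<close> is at most a multiple of \<open>norm H\<close>, so that \<open>trace E\<close> is \<open>inv K \<bullet> H / 2\<close> to first order.
  Taking the trace thus spares solving the Sylvester equation for the derivative of the root itself.
\<close>

lemma trace_spd_sqrt_has_derivative:
  fixes M :: "real^'d^'d"
  assumes M: "spd M"
  shows "((\<lambda>M. trace (spd_sqrt M)) has_derivative (\<lambda>H. (1/2) * (matrix_inv (spd_sqrt M) \<bullet> H)))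
    (at M within sym_matrices)"
proof -
  define K where "K = spd_sqrt M"
  have K: "spd K" "K ** K = M" using spd_spd_sqrt[OF M] spd_sqrt_square[OF M] by (simp_all add: K_def)
  obtain a where a: "a > 0" "\<And>v. a * (norm v)\<^sup>2 \<le> v \<bullet> (K *v v)" using spd_coercive[OF K(1)] by blast
  obtain c where c: "c > 0" "\<And>v. c * (norm v)\<^sup>2 \<le> v \<bullet> (M *v v)" using spd_coercive[OF M] by blast
  note inv = matrix_inv_spd[OF K(1)]
  have "norm (trace (spd_sqrt N) - trace (spd_sqrt M) - 1/2 * (matrix_inv (spd_sqrt M) \<bullet> (N - M)))
      \<le> (1 / (2 * a ^ 2) * norm (matrix_inv K)) * (norm (N - M))\<^sup>2"
    if N: "N \<in> sym_matrices" "norm (N - M) < c" for N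
  proof -
    have "spd (M + (N - M))"
      by (rule spd_perturb[OF spd_symmetric[OF M] _ c(2)])
        (use N spd_symmetric[OF M] in \<open>auto simp: sym_matrices_def transpose_diff\<close>)
    then have spdN: "spd N" by simp
    define L where "L = spd_sqrt N"
    have L: "spd L" "L ** L = N" using spd_spd_sqrt[OF spdN] spd_sqrt_square[OF spdN] by (simp_all add: L_def)
    define E where "E = L - K"
    \<comment> \<open>nonnegativity is the lower bound for \<open>L\<close> that is uniform in \<open>N\<close>\<close>
    have "0 * (norm v)\<^sup>2 \<le> v \<bullet> (L *v v)" for v
      using L(1) unfolding spd_def by (cases "v = 0") (auto simp: less_imp_le)
    from sqrt_lipschitz_coercive[OF spd_symmetric[OF L(1)] a(2) this]
    have "a * norm E \<le> norm (N - M)"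
      by (simp add: K L E_def norm_minus_commute)
    then have E: "norm E \<le> norm (N - M) / a" using a(1) by (simp add: field_simps)
    have "N - M = K ** E + E ** K + E ** E"
      unfolding E_def K(2)[symmetric] L(2)[symmetric]
      by (simp add: matrix_left_diff_distrib matrix_right_diff_distrib)
    then have "matrix_inv K \<bullet> (N - M)
        = matrix_inv K \<bullet> (K ** E) + matrix_inv K \<bullet> (E ** K) + matrix_inv K \<bullet> (E ** E)"
      by (simp add: inner_add_right)
    also have "matrix_inv K \<bullet> (K ** E) = trace E"
      using frobenius_adjoint_left[of K E "matrix_inv K"] spd_symmetric[OF K(1)] inv
      by (simp add: inner_commute trace_eq_inner_mat1)
    also have "matrix_inv K \<bullet> (E ** K) = trace E"
      using frobenius_adjoint_right[of E K "matrix_inv K"] spd_symmetric[OF K(1)] inv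
      by (simp add: inner_commute trace_eq_inner_mat1)
    finally have "trace L - trace K - 1/2 * (matrix_inv K \<bullet> (N - M)) = - (1/2) * (matrix_inv K \<bullet> (E ** E))"
      by (simp add: E_def trace_sub field_simps)
    then have "norm (trace L - trace K - 1/2 * (matrix_inv K \<bullet> (N - M))) = 1/2 * \<bar>matrix_inv K \<bullet> (E ** E)\<bar>"
      by (simp add: abs_mult)
    also have "\<dots> \<le> 1/2 * (norm (matrix_inv K) * norm (E ** E))"
      by (intro mult_left_mono Cauchy_Schwarz_ineq2) auto
    also have "\<dots> \<le> 1/2 * (norm (matrix_inv K) * (norm E * norm E))"
      by (intro mult_left_mono norm_matrix_mult_left_le norm_le_norm_matrix) auto
    also have "\<dots> \<le> 1/2 * (norm (matrix_inv K) * ((norm (N - M) / a) * (norm (N - M) / a)))"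
      using a(1) by (intro mult_left_mono mult_mono E) auto
    also have "\<dots> = (1 / (2 * a ^ 2) * norm (matrix_inv K)) * (norm (N - M))\<^sup>2"
      by (simp add: power2_eq_square)
    finally show ?thesis by (simp add: L_def K_def)
  qed
  then show ?thesis
    by (rule has_derivative_quadratic_remainder[OF _ c(1), rotated])
      (assumption | intro bounded_linear_const_mult bounded_linear_inner_right)+
qed

section \<open>Symmetric gradients\<close>

lemma sym_matrices_scaleR: "G \<in> sym_matrices \<Longrightarrow> c *\<^sub>R G \<in> sym_matrices"
  by (simp add: sym_matrices_def transpose_scalar)

lemma has_sym_gradient_add:
  assumes "has_sym_gradient f F X" "has_sym_gradient g G X"
  shows "has_sym_gradient (\<lambda>X. f X + g X) (F + G) X"
  using assms has_derivative_add[of f "\<lambda>H. F \<bullet> H" "at X within sym_matrices" g "\<lambda>H. G \<bullet> H"]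
  by (auto simp: has_sym_gradient_def sym_matrices_def transpose_add inner_add_left)

lemma has_sym_gradient_cmult:
  assumes "has_sym_gradient f F X"
  shows "has_sym_gradient (\<lambda>X. c * f X) (c *\<^sub>R F) X"
  using assms has_derivative_mult_right[of f "\<lambda>H. F \<bullet> H" "at X within sym_matrices" c]
  by (auto simp: has_sym_gradient_def sym_matrices_scaleR)

lemma has_sym_gradient_const: "has_sym_gradient (\<lambda>X. c) 0 X"
  by (simp add: has_sym_gradient_def sym_matrices_def transpose_def vec_eq_iff)

lemma has_sym_gradient_sum:
  assumes "\<And>i. i \<in> I \<Longrightarrow> has_sym_gradient (f i) (G i) X"
  shows "has_sym_gradient (\<lambda>X. \<Sum>i\<in>I. f i X) (\<Sum>i\<in>I. G i) X"
  using assms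
  by (induction I rule: infinite_finite_induct)
    (auto simp: has_sym_gradient_const intro!: has_sym_gradient_add)

lemma has_sym_gradient_compose:
  assumes "has_sym_gradient f F X" "(\<phi> has_real_derivative D) (at (f X))"
  shows "has_sym_gradient (\<lambda>X. \<phi> (f X)) (D *\<^sub>R F) X"
  using assms has_derivative_compose[of f "\<lambda>H. F \<bullet> H" X sym_matrices \<phi> "(*) D"]
  by (auto simp: has_sym_gradient_def sym_matrices_scaleR has_field_derivative_def)

lemma has_sym_gradient_det:
  assumes "spd X" shows "has_sym_gradient det (det X *\<^sub>R matrix_inv X) X"
  using det_has_derivative[OF assms] matrix_inv_symmetric[OF assms]
  by (simp add: has_sym_gradient_def sym_matrices_def transpose_scalar)

section \<open>The order interval between scalar matrices\<close>

lemma mat_mult_vec: "mat c *v v = c *\<^sub>R v" for v :: "real^'d"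
  by (simp add: matrix_vector_mult_def mat_def vec_eq_iff if_distribR if_distrib cong: if_cong)

lemma spd_betweenD:
  fixes X :: "real^'d^'d"
  assumes "X \<in> spd_between \<alpha> \<beta>"
  shows "spd X" "transpose X = X" "\<alpha> * (norm v)\<^sup>2 \<le> v \<bullet> (X *v v)" "v \<bullet> (X *v v) \<le> \<beta> * (norm v)\<^sup>2"
proof -
  show "spd X" "transpose X = X" using assms by (simp_all add: spd_between_def spd_symmetric)
  have "0 \<le> v \<bullet> ((X - mat \<alpha>) *v v)" "0 \<le> v \<bullet> ((mat \<beta> - X) *v v)"
    using assms by (simp_all add: spd_between_def loewner_le_def psd_def)
  then show "\<alpha> * (norm v)\<^sup>2 \<le> v \<bullet> (X *v v)" "v \<bullet> (X *v v) \<le> \<beta> * (norm v)\<^sup>2"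
    by (simp_all add: matrix_vector_mult_diff_rdistrib mat_mult_vec inner_diff_right power2_norm_eq_inner)
qed

lemma spd_betweenI:
  fixes X :: "real^'d^'d"
  assumes "transpose X = X" "0 < \<alpha>"
    and "\<And>v. \<alpha> * (norm v)\<^sup>2 \<le> v \<bullet> (X *v v)" "\<And>v. v \<bullet> (X *v v) \<le> \<beta> * (norm v)\<^sup>2"
  shows "X \<in> spd_between \<alpha> \<beta>"
  using spd_if_coercive[OF assms(1-3)] assms
  by (simp add: spd_between_def loewner_le_def psd_def sym_matrices_def transpose_diff
      matrix_vector_mult_diff_rdistrib mat_mult_vec inner_diff_right power2_norm_eq_inner)

lemma convex_spd_between:
  assumes "0 < \<alpha>" shows "convex (spd_between \<alpha> \<beta> :: (real^'d^'d) set)"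
proof (rule convexI)
  fix X Y :: "real^'d^'d" and s t :: real
  assume X: "X \<in> spd_between \<alpha> \<beta>" and Y: "Y \<in> spd_between \<alpha> \<beta>" and st: "0 \<le> s" "0 \<le> t" "s + t = 1"
  have quad: "v \<bullet> ((s *\<^sub>R X + t *\<^sub>R Y) *v v) = s * (v \<bullet> (X *v v)) + t * (v \<bullet> (Y *v v))" for v
    by (simp add: matrix_vector_mult_add_rdistrib scaleR_matrix_vector_assoc[symmetric] inner_add_right)
  have mix: "c * (norm v)\<^sup>2 = s * (c * (norm v)\<^sup>2) + t * (c * (norm v)\<^sup>2)" for c and v :: "real^'d"
    using st(3) by (metis distrib_right mult_1)
  show "s *\<^sub>R X + t *\<^sub>R Y \<in> spd_between \<alpha> \<beta>"
  proof (rule spd_betweenI[OF _ assms])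
    show "transpose (s *\<^sub>R X + t *\<^sub>R Y) = s *\<^sub>R X + t *\<^sub>R Y"
      using X Y by (simp add: transpose_add transpose_scalar spd_betweenD)
    fix v :: "real^'d"
    show "\<alpha> * (norm v)\<^sup>2 \<le> v \<bullet> ((s *\<^sub>R X + t *\<^sub>R Y) *v v)"
      by (subst mix, unfold quad)
        (intro add_mono mult_left_mono spd_betweenD(3)[OF X] spd_betweenD(3)[OF Y] st)
    show "v \<bullet> ((s *\<^sub>R X + t *\<^sub>R Y) *v v) \<le> \<beta> * (norm v)\<^sup>2"
      by (subst mix, unfold quad)
        (intro add_mono mult_left_mono spd_betweenD(4)[OF X] spd_betweenD(4)[OF Y] st)
  qed
qed

text \<open>
  The determinant is the product of the eigenvalues, all of which lie between \<open>\<alpha>\<close> and \<open>\<beta>\<close>.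
\<close>

lemma det_bounds:
  fixes X :: "real^'d^'d"
  assumes X: "X \<in> spd_between \<alpha> \<beta>" and "0 < \<alpha>"
  shows "\<alpha> ^ CARD('d) \<le> det X" "det X \<le> \<beta> ^ CARD('d)"
proof -
  obtain P D where P: "orthogonal_matrix P" and XD: "X = P ** diag_matrix D ** transpose P"
    and ev: "\<And>i. X *v column i P = D i *\<^sub>R column i P" "\<And>i. norm (column i P) = 1"
    using symmetric_orthogonal_diagonalization[OF spd_betweenD(2)[OF X]] by metis
  have D: "\<alpha> \<le> D i" "D i \<le> \<beta>" for i
  proof -
    have "column i P \<bullet> column i P = 1" using ev(2)[of i] by (simp add: norm_eq_1)
    then show "\<alpha> \<le> D i" "D i \<le> \<beta>"
      using spd_betweenD(3,4)[OF X, of "column i P"] by (simp_all add: ev)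
  qed
  have "det P * det (transpose P) = 1"
    using P by (metis det_I det_mul orthogonal_matrix_def)
  then have "det X = det (diag_matrix D)" by (simp add: XD det_mul)
  also have "\<dots> = (\<Prod>i\<in>UNIV. D i)"
    by (subst det_diagonal) (simp_all add: diag_matrix_def)
  finally have det: "det X = (\<Prod>i\<in>UNIV. D i)" .
  have "(\<Prod>i\<in>(UNIV :: 'd set). \<alpha>) \<le> (\<Prod>i\<in>UNIV. D i)"
    using D assms(2) by (intro prod_mono) auto
  then show "\<alpha> ^ CARD('d) \<le> det X" by (simp add: det)
  have "0 \<le> D i" for i using D(1)[of i] assms(2) by simp
  then have "(\<Prod>i\<in>UNIV. D i) \<le> (\<Prod>i\<in>(UNIV :: 'd set). \<beta>)"
    using D by (intro prod_mono) auto
  then show "det X \<le> \<beta> ^ CARD('d)" by (simp add: det)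
qed

lemma det_pos: "X \<in> spd_between \<alpha> \<beta> \<Longrightarrow> 0 < \<alpha> \<Longrightarrow> 0 < det X" for X :: "real^'d^'d"
  using det_bounds(1)[of X \<alpha> \<beta>] by (meson less_le_trans zero_less_power)

section \<open>The Wasserstein part of the objective\<close>

text \<open>
  The matrix of the linear optimal transport map from \<open>N(0, X)\<close> to \<open>N(0, A)\<close>.
\<close>

definition transport_matrix :: "real^'d^'d \<Rightarrow> real^'d^'d \<Rightarrow> real^'d^'d" where
  "transport_matrix A X = spd_sqrt A ** matrix_inv (spd_sqrt (spd_sqrt A ** X ** spd_sqrt A)) ** spd_sqrt A"

lemma spd_congruence:
  fixes S X :: "real^'d^'d"
  assumes "spd S" "spd X"
  shows "spd (S ** X ** S)"
  unfolding spd_def sym_matrices_def mem_Collect_eq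
proof (intro conjI allI impI)
  note S = spd_symmetric[OF assms(1)]
  show "transpose (S ** X ** S) = S ** X ** S"
    by (simp add: matrix_transpose_mul matrix_mul_assoc S spd_symmetric assms)
  fix v :: "real^'d" assume "v \<noteq> 0"
  then have "S *v v \<noteq> 0"
    using assms(1) unfolding spd_def by (metis inner_zero_right less_irrefl)
  then have "0 < (S *v v) \<bullet> (X *v (S *v v))" using assms(2) by (simp add: spd_def)
  then show "0 < v \<bullet> ((S ** X ** S) *v v)"
    by (simp add: symmetric_inner_swap[OF S] matrix_vector_mul_assoc matrix_mul_assoc)
qed

text \<open>
  Chain rule for the trace of the square root after the linear map \<open>X \<mapsto> S X S\<close>, \<open>S\<close> the root of \<open>A\<close>;
  this map is its own adjoint, which moves \<open>S\<close> to both sides of the inverse root.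
\<close>

lemma fidelity_has_sym_gradient:
  fixes A X :: "real^'d^'d"
  assumes A: "spd A" and X: "spd X"
  shows "has_sym_gradient (\<lambda>X. trace (spd_sqrt (spd_sqrt A ** X ** spd_sqrt A)))
    ((1/2) *\<^sub>R transport_matrix A X) X"
proof -
  define S where "S = spd_sqrt A"
  have S: "spd S" using spd_spd_sqrt[OF A] by (simp add: S_def)
  note St = spd_symmetric[OF S]
  define K where "K = spd_sqrt (S ** X ** S)"
  have M: "spd (S ** X ** S)" by (rule spd_congruence[OF S X])
  have K: "spd K" using spd_spd_sqrt[OF M] by (simp add: K_def)
  have lin: "((\<lambda>X. S ** X ** S) has_derivative (\<lambda>H. S ** H ** S)) (at X within sym_matrices)"
    by (intro bounded_linear_imp_has_derivative
        bounded_linear_compose[OF bounded_linear_matrix_mult_right bounded_linear_matrix_mult_left])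
  have sub: "(\<lambda>X. S ** X ** S) ` sym_matrices \<subseteq> sym_matrices"
    by (auto simp: sym_matrices_def matrix_transpose_mul St matrix_mul_assoc)
  have "((\<lambda>M. trace (spd_sqrt M)) has_derivative (\<lambda>H. (1/2) * (matrix_inv K \<bullet> H)))
    (at (S ** X ** S) within (\<lambda>X. S ** X ** S) ` sym_matrices)"
    using trace_spd_sqrt_has_derivative[OF M] sub unfolding K_def by (rule has_derivative_subset)
  from has_derivative_in_compose[OF lin this]
  have "((\<lambda>X. trace (spd_sqrt (S ** X ** S))) has_derivative (\<lambda>H. (1/2) * (matrix_inv K \<bullet> (S ** H ** S))))
    (at X within sym_matrices)" .
  moreover have "matrix_inv K \<bullet> (S ** H ** S) = (S ** matrix_inv K ** S) \<bullet> H" for H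
    using frobenius_adjoint_left[of S "matrix_inv K ** S" H] frobenius_adjoint_right[of "matrix_inv K" S "S ** H"]
    by (simp add: St matrix_mul_assoc)
  ultimately show ?thesis
    by (simp add: has_sym_gradient_def transport_matrix_def S_def[symmetric] K_def[symmetric]
        sym_matrices_def transpose_scalar matrix_transpose_mul St matrix_inv_symmetric[OF K] matrix_mul_assoc)
qed

lemma f1_has_sym_gradient:
  fixes A :: "nat \<Rightarrow> real^'d^'d" and X :: "real^'d^'d"
  assumes A: "\<And>i. i \<in> {1..n} \<Longrightarrow> spd (A i)" and X: "spd X"
  shows "has_sym_gradient (f1 n lam A) (\<Sum>i=1..n. lam i *\<^sub>R (mat 1 - transport_matrix (A i) X)) X"
proof -
  have tr: "has_sym_gradient (\<lambda>X :: real^'d^'d. trace X) (mat 1) X"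
    unfolding has_sym_gradient_def trace_eq_inner_mat1
    by (auto simp: sym_matrices_def intro!: bounded_linear_imp_has_derivative bounded_linear_inner_right)
  have "f1 n lam A = (\<lambda>X. (\<Sum>i=1..n. lam i * trace (A i)) + (\<Sum>i=1..n. lam i *
      (trace X + (-2) * trace (spd_sqrt (spd_sqrt (A i) ** X ** spd_sqrt (A i))))))"
    by (simp add: fun_eq_iff f1_def trace_eq_inner_mat1 inner_diff_right)
  moreover have "has_sym_gradient \<dots>
      (0 + (\<Sum>i=1..n. lam i *\<^sub>R (mat 1 + (-2) *\<^sub>R ((1/2) *\<^sub>R transport_matrix (A i) X)))) X"
    by (intro has_sym_gradient_add has_sym_gradient_const has_sym_gradient_sum has_sym_gradient_cmult
        tr fidelity_has_sym_gradient A X)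
  ultimately show ?thesis by simp
qed

text \<open>
  Let \<open>S\<close> be the root of \<open>A\<close> and \<open>K Z\<close> that of \<open>S Z S\<close>. The constant is a product of four: conjugation by \<open>S\<close>
  costs \<open>\<beta>\<close> and occurs inside and outside; as \<open>S Z S \<ge> \<alpha> A \<ge> \<alpha>\<^sup>2 I\<close>, one has \<open>K Z \<ge> \<alpha> I\<close>, so that the
  square root costs \<open>1 / (2 \<alpha>)\<close> and the inversion \<open>1 / \<alpha>\<^sup>2\<close>.
\<close>

lemma transport_matrix_lipschitz:
  fixes A X Y :: "real^'d^'d"
  assumes \<alpha>: "0 < \<alpha>" and A: "A \<in> spd_between \<alpha> \<beta>"
    and X: "X \<in> spd_between \<alpha> \<beta>" and Y: "Y \<in> spd_between \<alpha> \<beta>"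
  shows "norm (transport_matrix A X - transport_matrix A Y) \<le> \<beta>\<^sup>2 / (2 * \<alpha> ^ 3) * norm (X - Y)"
proof -
  define S where "S = spd_sqrt A"
  have S: "spd S" "S ** S = A"
    using spd_spd_sqrt[OF spd_betweenD(1)[OF A]] spd_sqrt_square[OF spd_betweenD(1)[OF A]]
    by (simp_all add: S_def)
  note St = spd_symmetric[OF S(1)]
  have S2: "(norm (S *v v))\<^sup>2 = v \<bullet> (A *v v)" for v
    by (simp add: power2_norm_eq_inner symmetric_inner_swap[OF St] matrix_vector_mul_assoc S(2))
  \<comment> \<open>any nonzero vector shows \<open>\<alpha> \<le> \<beta>\<close>\<close>
  have "\<alpha> * (norm (axis undefined 1 :: real^'d))\<^sup>2 \<le> \<beta> * (norm (axis undefined 1 :: real^'d))\<^sup>2"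
    using spd_betweenD(3,4)[OF A] by (rule order_trans)
  then have \<beta>: "0 \<le> \<beta>" using \<alpha> by simp
  have Sle: "norm (S *v v) \<le> sqrt \<beta> * norm v" for v
  proof (rule power2_le_imp_le)
    show "(norm (S *v v))\<^sup>2 \<le> (sqrt \<beta> * norm v)\<^sup>2"
      unfolding S2 using spd_betweenD(4)[OF A] \<beta> by (simp add: power_mult_distrib)
  qed (use \<beta> in simp)
  have conj_le: "norm (S ** E ** S) \<le> \<beta> * norm E" for E
  proof -
    have "norm (S ** E ** S) \<le> sqrt \<beta> * norm (S ** E)"
      by (rule norm_matrix_mult_right_le[OF St Sle])
    also have "\<dots> \<le> sqrt \<beta> * (sqrt \<beta> * norm E)"
      using \<beta> by (intro mult_left_mono norm_matrix_mult_left_le Sle) auto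
    finally show ?thesis using \<beta> by (simp add: mult.assoc[symmetric])
  qed
  define K where "K Z = spd_sqrt (S ** Z ** S)" for Z
  have K: "spd (K Z)" "K Z ** K Z = S ** Z ** S" "\<And>v. \<alpha> * (norm v)\<^sup>2 \<le> v \<bullet> (K Z *v v)"
    if Z: "Z \<in> spd_between \<alpha> \<beta>" for Z
  proof -
    have "spd (S ** Z ** S)" by (rule spd_congruence[OF S(1) spd_betweenD(1)[OF Z]])
    then show K1: "spd (K Z)" and K2: "K Z ** K Z = S ** Z ** S"
      by (simp_all add: K_def spd_spd_sqrt spd_sqrt_square)
    have "\<alpha>\<^sup>2 * (norm v)\<^sup>2 \<le> v \<bullet> ((K Z ** K Z) *v v)" for v
    proof -
      have "\<alpha>\<^sup>2 * (norm v)\<^sup>2 \<le> \<alpha> * (norm (S *v v))\<^sup>2"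
        unfolding S2 using spd_betweenD(3)[OF A, of v] \<alpha> by (simp add: power2_eq_square mult.assoc)
      also have "\<dots> \<le> (S *v v) \<bullet> (Z *v (S *v v))" by (rule spd_betweenD(3)[OF Z])
      also have "\<dots> = v \<bullet> ((K Z ** K Z) *v v)"
        by (simp add: K2 symmetric_inner_swap[OF St] matrix_vector_mul_assoc matrix_mul_assoc)
      finally show ?thesis .
    qed
    then show "\<alpha> * (norm v)\<^sup>2 \<le> v \<bullet> (K Z *v v)" for v by (rule coercive_of_square[OF K1])
  qed
  have "(\<alpha> + \<alpha>) * norm (K X - K Y) \<le> norm (K X ** K X - K Y ** K Y)"
    by (rule sqrt_lipschitz_coercive[OF spd_symmetric[OF K(1)[OF Y]] K(3)[OF X] K(3)[OF Y]])
  also have "K X ** K X - K Y ** K Y = S ** (X - Y) ** S"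
    by (simp add: K(2) X Y matrix_left_diff_distrib matrix_right_diff_distrib)
  also have "norm \<dots> \<le> \<beta> * norm (X - Y)" by (rule conj_le)
  finally have KL: "norm (K X - K Y) \<le> \<beta> * norm (X - Y) / (2 * \<alpha>)" using \<alpha> by (simp add: field_simps)
  have "transport_matrix A X - transport_matrix A Y = S ** (matrix_inv (K X) - matrix_inv (K Y)) ** S"
    by (simp add: transport_matrix_def S_def[symmetric] K_def matrix_left_diff_distrib matrix_right_diff_distrib)
  also have "norm \<dots> \<le> \<beta> * norm (matrix_inv (K X) - matrix_inv (K Y))" by (rule conj_le)
  also have "\<dots> \<le> \<beta> * (norm (K X - K Y) / \<alpha>\<^sup>2)"
    using \<alpha> \<beta> K[OF X] K[OF Y] by (intro mult_left_mono norm_matrix_inv_diff_le) auto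
  also have "\<dots> \<le> \<beta> * (\<beta> * norm (X - Y) / (2 * \<alpha>) / \<alpha>\<^sup>2)"
    using \<beta> KL by (intro mult_left_mono divide_right_mono) auto
  also have "\<dots> = \<beta>\<^sup>2 / (2 * \<alpha> ^ 3) * norm (X - Y)"
    by (simp add: power2_eq_square power3_eq_cube)
  finally show ?thesis .
qed

lemma f1_gradient_lipschitz:
  fixes A :: "nat \<Rightarrow> real^'d^'d" and X Y :: "real^'d^'d"
  assumes \<alpha>: "0 < \<alpha>" and A: "\<And>i. i \<in> {1..n} \<Longrightarrow> A i \<in> spd_between \<alpha> \<beta>"
    and lam: "\<And>i. i \<in> {1..n} \<Longrightarrow> lam i \<ge> 0" "(\<Sum>i=1..n. lam i) = 1"
    and X: "X \<in> spd_between \<alpha> \<beta>" and Y: "Y \<in> spd_between \<alpha> \<beta>"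
  shows "norm ((\<Sum>i=1..n. lam i *\<^sub>R (mat 1 - transport_matrix (A i) X))
      - (\<Sum>i=1..n. lam i *\<^sub>R (mat 1 - transport_matrix (A i) Y))) \<le> \<beta>\<^sup>2 / (2 * \<alpha> ^ 3) * norm (X - Y)"
proof -
  have "(\<Sum>i=1..n. lam i *\<^sub>R (mat 1 - transport_matrix (A i) X))
      - (\<Sum>i=1..n. lam i *\<^sub>R (mat 1 - transport_matrix (A i) Y))
      = (\<Sum>i=1..n. lam i *\<^sub>R (transport_matrix (A i) Y - transport_matrix (A i) X))"
    by (simp add: sum_subtractf[symmetric] scaleR_diff_right[symmetric])
  also have "norm \<dots> \<le> (\<Sum>i=1..n. lam i * (\<beta>\<^sup>2 / (2 * \<alpha> ^ 3) * norm (X - Y)))"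
  proof (rule sum_norm_le)
    fix i assume i: "i \<in> {1..n}"
    show "norm (lam i *\<^sub>R (transport_matrix (A i) Y - transport_matrix (A i) X))
        \<le> lam i * (\<beta>\<^sup>2 / (2 * \<alpha> ^ 3) * norm (X - Y))"
      using mult_left_mono[OF transport_matrix_lipschitz[OF \<alpha> A[OF i] Y X] lam(1)[OF i]] lam(1)[OF i]
      by (simp only: norm_scaleR abs_of_nonneg norm_minus_commute)
  qed
  also have "\<dots> = \<beta>\<^sup>2 / (2 * \<alpha> ^ 3) * norm (X - Y)"
    by (simp only: sum_distrib_right[symmetric] lam(2) mult_1)
  finally show ?thesis .
qed

section \<open>The entropy part of the objective\<close>

text \<open>
  Split the difference as \<open>(det X)\<^sup>p (inv X - inv Y) + ((det X)\<^sup>p - (det Y)\<^sup>p) inv Y\<close>. The first part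
  contributes \<open>M / \<alpha>\<^sup>2\<close>. In the second, \<open>Z \<mapsto> (det Z)\<^sup>p\<close> has gradient \<open>p (det Z)\<^sup>p inv Z\<close>, of norm at most
  \<open>\<bar>p\<bar> M sqrt d / \<alpha>\<close>, so the mean value inequality on the convex order interval applies; the
  remaining factor \<open>inv Y\<close> contributes another \<open>sqrt d / \<alpha>\<close>, which makes \<open>M / \<alpha>\<^sup>2 \<cdot> \<bar>p\<bar> d\<close>.
\<close>

lemma det_powr_inverse_lipschitz:
  fixes X Y :: "real^'d^'d"
  assumes \<alpha>: "0 < \<alpha>" and X: "X \<in> spd_between \<alpha> \<beta>" and Y: "Y \<in> spd_between \<alpha> \<beta>"
    and M: "\<And>Z :: real^'d^'d. Z \<in> spd_between \<alpha> \<beta> \<Longrightarrow> det Z powr p \<le> M"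
  shows "norm (det X powr p *\<^sub>R matrix_inv X - det Y powr p *\<^sub>R matrix_inv Y)
    \<le> M / \<alpha>\<^sup>2 * (1 + \<bar>p\<bar> * real CARD('d)) * norm (X - Y)"
proof -
  let ?d = "real CARD('d)"
  have M0: "0 \<le> M" using M[OF X] by (meson order_trans powr_ge_zero)
  have inv: "norm (matrix_inv Z) \<le> sqrt ?d / \<alpha>" if "Z \<in> spd_between \<alpha> \<beta>" for Z :: "real^'d^'d"
    using that by (intro norm_matrix_inv_le \<alpha> spd_betweenD)
  have "norm (det X powr p - det Y powr p) \<le> (\<bar>p\<bar> * M * (sqrt ?d / \<alpha>)) * norm (X - Y)"
  proof (rule differentiable_bound[OF convex_spd_between[OF \<alpha>] _ _ X Y])
    fix Z :: "real^'d^'d" assume Z: "Z \<in> spd_between \<alpha> \<beta>"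
    have pos: "0 < det Z" using Z \<alpha> by (rule det_pos)
    have "((\<lambda>t. t powr p) has_derivative (*) (p * det Z powr (p - 1))) (at (det Z))"
      using has_real_derivative_powr[OF pos, of p] by (simp add: has_field_derivative_def)
    from has_derivative_compose[OF det_has_derivative[OF spd_betweenD(1)[OF Z]] this]
    show "((\<lambda>Z. det Z powr p) has_derivative (\<lambda>H. (p * det Z powr p) * (matrix_inv Z \<bullet> H)))
        (at Z within spd_between \<alpha> \<beta>)"
      using pos by (simp add: powr_diff mult.assoc)
    show "onorm (\<lambda>H. (p * det Z powr p) * (matrix_inv Z \<bullet> H)) \<le> \<bar>p\<bar> * M * (sqrt ?d / \<alpha>)"
    proof (rule onorm_le)
      fix H :: "real^'d^'d"
      have "norm ((p * det Z powr p) * (matrix_inv Z \<bullet> H)) = \<bar>p\<bar> * det Z powr p * \<bar>matrix_inv Z \<bullet> H\<bar>"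
        by (simp add: abs_mult)
      also have "\<dots> \<le> \<bar>p\<bar> * M * ((sqrt ?d / \<alpha>) * norm H)"
      proof (intro mult_mono)
        show "\<bar>matrix_inv Z \<bullet> H\<bar> \<le> sqrt ?d / \<alpha> * norm H"
          by (rule order_trans[OF Cauchy_Schwarz_ineq2 mult_right_mono[OF inv[OF Z]]]) simp
      qed (use M[OF Z] M0 in auto)
      finally show "norm ((p * det Z powr p) * (matrix_inv Z \<bullet> H)) \<le> \<bar>p\<bar> * M * (sqrt ?d / \<alpha>) * norm H"
        by (simp add: mult.assoc)
    qed
  qed
  then have det: "\<bar>det X powr p - det Y powr p\<bar> \<le> (\<bar>p\<bar> * M * (sqrt ?d / \<alpha>)) * norm (X - Y)" by simp
  have "det X powr p *\<^sub>R matrix_inv X - det Y powr p *\<^sub>R matrix_inv Y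
      = det X powr p *\<^sub>R (matrix_inv X - matrix_inv Y) + (det X powr p - det Y powr p) *\<^sub>R matrix_inv Y"
    by (simp add: algebra_simps)
  also have "norm \<dots> \<le> det X powr p * norm (matrix_inv X - matrix_inv Y)
      + \<bar>det X powr p - det Y powr p\<bar> * norm (matrix_inv Y)"
    by (rule order_trans[OF norm_triangle_ineq]) simp
  also have "\<dots> \<le> M * (norm (X - Y) / \<alpha>\<^sup>2)
      + (\<bar>p\<bar> * M * (sqrt ?d / \<alpha>)) * norm (X - Y) * (sqrt ?d / \<alpha>)"
    using M0 \<alpha> by (intro add_mono mult_mono M[OF X] det inv[OF Y] norm_matrix_inv_diff_le
        spd_betweenD(1,3)[OF X] spd_betweenD(1,3)[OF Y]) auto
  also have "\<dots> = M / \<alpha>\<^sup>2 * (1 + \<bar>p\<bar> * (sqrt ?d * sqrt ?d)) * norm (X - Y)"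
    using \<alpha> by (simp add: field_simps power2_eq_square)
  finally show ?thesis by simp
qed

lemma ln_det_has_sym_gradient:
  fixes X :: "real^'d^'d"
  assumes "0 < \<alpha>" "X \<in> spd_between \<alpha> \<beta>"
  shows "has_sym_gradient (\<lambda>X. ln (det X)) (matrix_inv X) X"
proof -
  have pos: "0 < det X" using assms by (metis det_pos)
  show ?thesis
    using has_sym_gradient_compose[OF has_sym_gradient_det[OF spd_betweenD(1)[OF assms(2)]] DERIV_ln[OF pos]] pos
    by simp
qed

text \<open>
  The upper limit \<open>(d + 4) / (d + 2)\<close> for \<open>q\<close> is the point where \<open>2 + (d + 2) (1 - q)\<close> vanishes; below it,
  all arguments of the Gamma function in \<open>C0\<close> are positive.
\<close>

lemma C0_pos:
  assumes "(0 < q \<and> q < 1) \<or> (1 < q \<and> q < (real d + 4) / (real d + 2))"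
  shows "0 < 2 + (real d + 2) * (1 - q)" "0 < C0 q d"
proof -
  show den: "0 < 2 + (real d + 2) * (1 - q)"
  proof (cases "q < 1")
    case True
    then have "0 \<le> (real d + 2) * (1 - q)" by simp
    then show ?thesis by linarith
  next
    case False
    with assms have "q * (real d + 2) < real d + 4" by (auto simp: pos_less_divide_eq)
    then show ?thesis by (simp add: algebra_simps)
  qed
  show "0 < C0 q d"
  proof (cases "q < 1")
    case True
    then have "0 < (2 - q) / (1 - q)" "0 < (2 - q) / (1 - q) + real d / 2"
      by (auto intro!: add_pos_nonneg)
    moreover have "0 < ((1 - q) * C1 q d / (2 * pi)) powr (real d / 2)"
      using True den by (simp add: C1_def)
    ultimately show ?thesis
      unfolding C0_def if_P[OF True] by (intro mult_pos_pos divide_pos_pos[of "Gamma _"] Gamma_real_pos)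
  next
    case False
    with assms have q: "1 < q" by auto
    have "real d / 2 * (q - 1) < 1"
      using den q by argo
    then have "real d / 2 < 1 / (q - 1)" using q by (simp add: pos_less_divide_eq)
    then have "0 < 1 / (q - 1)" "0 < 1 / (q - 1) - real d / 2" using q by simp_all
    moreover have "0 < ((q - 1) * C1 q d / (2 * pi)) powr (real d / 2)"
      using q den by (simp add: C1_def)
    ultimately show ?thesis
      unfolding C0_def if_not_P[OF False]
      by (intro mult_pos_pos divide_pos_pos[of "Gamma _"] Gamma_real_pos)
  qed
qed

text \<open>
  For \<open>t > 0\<close> one has \<open>ln\<^sub>q (c / sqrt t) = (c\<^bsup>1-q\<^esup> t\<^bsup>(q-1)/2\<^esup> - 1) / (1 - q)\<close>. The factor \<open>det X\<close> of Jacobi's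
  formula raises the exponent of the derivative back to \<open>(q - 1) / 2\<close>.
\<close>

lemma ln_q_det_has_sym_gradient:
  fixes X :: "real^'d^'d"
  assumes "0 < \<alpha>" "X \<in> spd_between \<alpha> \<beta>" "q \<noteq> 1" "0 < c"
  shows "has_sym_gradient (\<lambda>X. ln_q q (c / sqrt (det X)))
    (- (1/2 * c powr (1 - q) * det X powr ((q - 1) / 2)) *\<^sub>R matrix_inv X) X"
proof -
  have pos: "0 < det X" using assms by (metis det_pos)
  have "((\<lambda>t. (c powr (1 - q) * t powr ((q - 1) / 2) - 1) / (1 - q)) has_real_derivative
      (c powr (1 - q) * ((q - 1) / 2 * det X powr ((q - 1) / 2 - 1))) / (1 - q)) (at (det X))"
    using pos assms(3) by (auto intro!: derivative_eq_intros has_real_derivative_powr)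
  also have "(c powr (1 - q) * ((q - 1) / 2 * det X powr ((q - 1) / 2 - 1))) / (1 - q)
      = - (1/2 * c powr (1 - q) * det X powr ((q - 1) / 2 - 1))"
    using assms(3) by (simp add: field_simps)
  finally have deriv: "((\<lambda>t. (c powr (1 - q) * t powr ((q - 1) / 2) - 1) / (1 - q)) has_real_derivative
      - (1/2 * c powr (1 - q) * det X powr ((q - 1) / 2 - 1))) (at (det X))" .
  have eq: "(c powr (1 - q) * t powr ((q - 1) / 2) - 1) / (1 - q) = ln_q q (c / sqrt t)"
    if "t \<in> {0<..}" for t
  proof -
    have "(c / sqrt t) powr (1 - q) = c powr (1 - q) / (t powr (1/2)) powr (1 - q)"
      using that assms(4) by (simp add: powr_divide powr_half_sqrt)
    also have "(t powr (1/2)) powr (1 - q) = t powr (- ((q - 1) / 2))"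
      unfolding powr_powr by (rule arg_cong[where f = "(powr) t"]) (simp add: field_simps)
    also have "c powr (1 - q) / t powr (- ((q - 1) / 2)) = c powr (1 - q) * t powr ((q - 1) / 2)"
      by (simp only: powr_minus divide_inverse inverse_inverse_eq)
    finally have "(c / sqrt t) powr (1 - q) = c powr (1 - q) * t powr ((q - 1) / 2)" .
    then show ?thesis by (simp add: ln_q_def)
  qed
  have "((\<lambda>t. ln_q q (c / sqrt t)) has_real_derivative
      - (1/2 * c powr (1 - q) * det X powr ((q - 1) / 2 - 1))) (at (det X))"
    by (rule has_field_derivative_transform_within_open[OF deriv open_greaterThan _ eq]) (use pos in simp_all)
  from has_sym_gradient_compose[OF has_sym_gradient_det[OF spd_betweenD(1)[OF assms(2)]] this]
  show ?thesis using pos by (simp add: powr_diff)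
qed

lemma m_const_pos:
  assumes "(0 < q \<and> q < 1) \<or> (1 < q \<and> q < (real d + 4) / (real d + 2))"
  shows "0 < m_const q d"
proof -
  note pos = C0_pos[OF assms]
  have "q < 2"
  proof (cases "q < 1")
    case False
    with assms have "q < (real d + 4) / (real d + 2)" by auto
    also have "\<dots> \<le> 2" by (simp add: pos_divide_le_eq)
    finally show ?thesis .
  qed simp
  then show ?thesis unfolding m_const_def using pos by simp
qed

text \<open>
  This is how \<open>m(q, d)\<close> arises: the first factor is the coefficient of the \<open>q\<close>-logarithm in the
  objective, the second the constant in the gradient of the \<open>q\<close>-logarithm. Over the common denominator
  \<open>2 + (d + 2) (1 - q)\<close> the terms in \<open>d\<close> of the first factor cancel.
\<close>

lemma entropy_coefficient_eq_m_const:
  assumes "0 < 2 + (real d + 2) * (1 - q)"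
  shows "(2 - (1 - q) * real d * C1 q d) * (1/2 * C0 q d powr (1 - q)) = m_const q d"
proof -
  have "2 - a * (2 / D) = (2 * D - a * 2) / D" if "0 < D" for a D :: real
    using that by (simp add: diff_divide_distrib)
  from this[OF assms, of "(1 - q) * real d"]
  have "2 - (1 - q) * real d * C1 q d = (2 * (2 + (real d + 2) * (1 - q)) - (1 - q) * real d * 2) / (2 + (real d + 2) * (1 - q))"
    unfolding C1_def .
  also have "2 * (2 + (real d + 2) * (1 - q)) - (1 - q) * real d * 2 = 4 * (2 - q)"
    by (simp add: algebra_simps)
  finally have coeff: "2 - (1 - q) * real d * C1 q d = 4 * (2 - q) / (2 + (real d + 2) * (1 - q))" .
  have "4 * a / D * (1/2 * c) = 2 * a * c / D" for a c D :: real by simp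
  then show ?thesis unfolding coeff m_const_def .
qed

lemma f_gauss_has_sym_gradient:
  fixes A :: "nat \<Rightarrow> real^'d^'d" and X :: "real^'d^'d"
  assumes "0 < \<alpha>" and A: "\<And>i. i \<in> {1..n} \<Longrightarrow> A i \<in> spd_between \<alpha> \<beta>" and X: "X \<in> spd_between \<alpha> \<beta>"
  shows "has_sym_gradient (f_gauss n lam A \<gamma>)
    ((\<Sum>i=1..n. lam i *\<^sub>R (mat 1 - transport_matrix (A i) X)) - \<gamma> *\<^sub>R matrix_inv X) X"
proof -
  have "f_gauss n lam A \<gamma> = (\<lambda>X. f1 n lam A X + (- \<gamma>) * ln (det X)
      + (- \<gamma> * real CARD('d) * ln (2 * pi * exp 1)))"
    by (simp add: fun_eq_iff f_gauss_def)
  moreover have "has_sym_gradient \<dots>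
      ((\<Sum>i=1..n. lam i *\<^sub>R (mat 1 - transport_matrix (A i) X)) + (- \<gamma>) *\<^sub>R matrix_inv X + 0) X"
    by (intro has_sym_gradient_add has_sym_gradient_cmult has_sym_gradient_const f1_has_sym_gradient
        spd_betweenD(1)[OF A] spd_betweenD(1)[OF X] ln_det_has_sym_gradient[OF assms(1) X])
  ultimately show ?thesis by simp
qed

lemma g_qgauss_has_sym_gradient:
  fixes A :: "nat \<Rightarrow> real^'d^'d" and X :: "real^'d^'d"
  assumes "0 < \<alpha>" and A: "\<And>i. i \<in> {1..n} \<Longrightarrow> A i \<in> spd_between \<alpha> \<beta>" and X: "X \<in> spd_between \<alpha> \<beta>"
    and q: "(0 < q \<and> q < 1) \<or> (1 < q \<and> q < (real CARD('d) + 4) / (real CARD('d) + 2))"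
  shows "has_sym_gradient (g_qgauss n lam A \<gamma> q)
    ((\<Sum>i=1..n. lam i *\<^sub>R (mat 1 - transport_matrix (A i) X))
      - (\<gamma> * m_const q CARD('d)) *\<^sub>R (det X powr ((q - 1) / 2) *\<^sub>R matrix_inv X)) X"
proof -
  let ?k = "2 - (1 - q) * real CARD('d) * C1 q CARD('d)" and ?C = "C0 q CARD('d)"
  have "g_qgauss n lam A \<gamma> q = (\<lambda>X. f1 n lam A X + (\<gamma> * ?k) * ln_q q (?C / sqrt (det X))
      + (- \<gamma> * real CARD('d) * C1 q CARD('d)))"
    by (simp add: fun_eq_iff g_qgauss_def)
  moreover have "has_sym_gradient \<dots>
      ((\<Sum>i=1..n. lam i *\<^sub>R (mat 1 - transport_matrix (A i) X))
        + (\<gamma> * ?k) *\<^sub>R (- (1/2 * ?C powr (1 - q) * det X powr ((q - 1) / 2)) *\<^sub>R matrix_inv X) + 0) X"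
    using q by (intro has_sym_gradient_add has_sym_gradient_cmult has_sym_gradient_const f1_has_sym_gradient
        spd_betweenD(1)[OF A] spd_betweenD(1)[OF X] ln_q_det_has_sym_gradient[OF assms(1) X] C0_pos(2)) auto
  moreover have "(\<gamma> * ?k) *\<^sub>R (- (1/2 * ?C powr (1 - q) * det X powr ((q - 1) / 2)) *\<^sub>R matrix_inv X)
      = - ((\<gamma> * m_const q CARD('d)) *\<^sub>R (det X powr ((q - 1) / 2) *\<^sub>R matrix_inv X))"
    unfolding entropy_coefficient_eq_m_const[OF C0_pos(1)[OF q], symmetric] scaleR_scaleR scaleR_minus_left[symmetric]
    by (rule arg_cong[where f = "\<lambda>c. c *\<^sub>R matrix_inv X"]) (simp add: ac_simps)
  ultimately show ?thesis by (simp only: add_0_right add_uminus_conv_diff)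
qed

section \<open>The Lipschitz bounds\<close>

text \<open>
  Everything claimed about one objective follows from an explicit formula \<open>G\<close> for its gradient
  and a Lipschitz constant of \<open>G\<close>; halving the objective halves both.
\<close>

lemma sym_grad_bounds_from_gradient:
  fixes F :: "real^'d^'d \<Rightarrow> real"
  assumes grad: "\<And>X. X \<in> spd_between \<alpha> \<beta> \<Longrightarrow> has_sym_gradient F (G X) X"
    and L: "0 \<le> L" "L \<le> L'"
    and lip: "\<And>X Y. X \<in> spd_between \<alpha> \<beta> \<Longrightarrow> Y \<in> spd_between \<alpha> \<beta> \<Longrightarrow> norm (G X - G Y) \<le> L * norm (X - Y)"
  shows "(\<forall>X \<in> spd_between \<alpha> \<beta>. has_sym_gradient F (sym_grad F X) X)
      \<and> (\<forall>X \<in> spd_between \<alpha> \<beta>. \<forall>Y \<in> spd_between \<alpha> \<beta>. X \<noteq> Y \<longrightarrow>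
           norm (sym_grad F X - sym_grad F Y) / norm (X - Y) \<le> L')
      \<and> (\<exists>K. K-lipschitz_on (spd_between \<alpha> \<beta>) (sym_grad (\<lambda>X. F X / 2)))"
proof -
  have sym: "X \<in> sym_matrices" if "X \<in> spd_between \<alpha> \<beta>" for X :: "real^'d^'d"
    using spd_betweenD(2)[OF that] by (simp add: sym_matrices_def)
  have eq: "sym_grad F X = G X" if "X \<in> spd_between \<alpha> \<beta>" for X
    using sym_grad_eqI[OF sym[OF that] grad[OF that]] .
  have half: "sym_grad (\<lambda>X. F X / 2) X = (1/2) *\<^sub>R G X" if "X \<in> spd_between \<alpha> \<beta>" for X
    using sym_grad_eqI[OF sym[OF that] has_sym_gradient_cmult[OF grad[OF that], of "1/2"]] by simp
  have "(L / 2)-lipschitz_on (spd_between \<alpha> \<beta>) (sym_grad (\<lambda>X. F X / 2))"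
  proof (rule lipschitz_onI)
    fix X Y :: "real^'d^'d" assume XY: "X \<in> spd_between \<alpha> \<beta>" "Y \<in> spd_between \<alpha> \<beta>"
    then show "dist (sym_grad (\<lambda>X. F X / 2) X) (sym_grad (\<lambda>X. F X / 2) Y) \<le> L / 2 * dist X Y"
      using lip[OF XY] by (simp add: half dist_norm scaleR_diff_right[symmetric] del: scaleR_diff_right)
  qed (use L in simp)
  moreover have "norm (G X - G Y) / norm (X - Y) \<le> L'"
    if "X \<in> spd_between \<alpha> \<beta>" "Y \<in> spd_between \<alpha> \<beta>" "X \<noteq> Y" for X Y
  proof -
    have "norm (G X - G Y) \<le> L' * norm (X - Y)"
      using lip[OF that(1,2)] mult_right_mono[OF L(2) norm_ge_zero] by (rule order_trans)
    then show ?thesis using that(3) by (simp add: pos_divide_le_eq)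
  qed
  ultimately show ?thesis using grad by (auto simp: eq)
qed

text \<open>
  Both objectives have a gradient of this form: \<open>R\<close> is \<open>X \<mapsto> inv X\<close> for the Boltzmann entropy and
  \<open>X \<mapsto> (det X)\<^bsup>(q-1)/2\<^esup> inv X\<close> for the Tsallis entropy.
\<close>

lemma penalized_gradient_lipschitz:
  fixes A :: "nat \<Rightarrow> real^'d^'d" and X Y :: "real^'d^'d"
  assumes \<alpha>: "0 < \<alpha>" and A: "\<And>i. i \<in> {1..n} \<Longrightarrow> A i \<in> spd_between \<alpha> \<beta>"
    and lam: "\<And>i. i \<in> {1..n} \<Longrightarrow> lam i \<ge> 0" "(\<Sum>i=1..n. lam i) = 1"
    and c: "0 \<le> c" and R: "norm (R X - R Y) \<le> B * norm (X - Y)"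
    and X: "X \<in> spd_between \<alpha> \<beta>" and Y: "Y \<in> spd_between \<alpha> \<beta>"
  shows "norm (((\<Sum>i=1..n. lam i *\<^sub>R (mat 1 - transport_matrix (A i) X)) - c *\<^sub>R (R X :: real^'d^'d))
      - ((\<Sum>i=1..n. lam i *\<^sub>R (mat 1 - transport_matrix (A i) Y)) - c *\<^sub>R R Y))
    \<le> (\<beta>\<^sup>2 / (2 * \<alpha> ^ 3) + c * B) * norm (X - Y)"
proof -
  let ?S = "\<lambda>X. \<Sum>i=1..n. lam i *\<^sub>R (mat 1 - transport_matrix (A i) X)"
  have "(?S X - c *\<^sub>R R X) - (?S Y - c *\<^sub>R R Y) = (?S X - ?S Y) - c *\<^sub>R (R X - R Y)"
    by (simp add: scaleR_diff_right)
  also have "norm \<dots> \<le> norm (?S X - ?S Y) + norm (c *\<^sub>R (R X - R Y))"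
    by (rule norm_triangle_ineq4)
  also have "\<dots> \<le> \<beta>\<^sup>2 / (2 * \<alpha> ^ 3) * norm (X - Y) + c * (B * norm (X - Y))"
    using mult_left_mono[OF R c] c
    by (intro add_mono f1_gradient_lipschitz[OF \<alpha> A lam X Y]) simp_all
  finally show ?thesis by (simp add: distrib_right)
qed

theorem theorem1p2:
  fixes n :: nat and lam :: "nat \<Rightarrow> real" and A :: "nat \<Rightarrow> real^'d^'d"
    and \<alpha> \<beta> \<gamma> :: real
  assumes "n \<ge> 1"
    and "\<And>i. i \<in> {1..n} \<Longrightarrow> lam i \<ge> 0"
    and "(\<Sum>i=1..n. lam i) = 1"
    and "\<gamma> \<ge> 0"
    and "0 < \<alpha>" and "\<alpha> \<le> \<beta>"
    and "\<And>i. i \<in> {1..n} \<Longrightarrow> A i \<in> spd_between \<alpha> \<beta>"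
  shows
    "(let f = f_gauss n lam A \<gamma> in
        (\<forall>X \<in> spd_between \<alpha> \<beta>. has_sym_gradient f (sym_grad f X) X)
      \<and> (\<forall>X \<in> spd_between \<alpha> \<beta>. \<forall>Y \<in> spd_between \<alpha> \<beta>. X \<noteq> Y \<longrightarrow>
           norm (sym_grad f X - sym_grad f Y) / norm (X - Y)
             \<le> \<beta>^2 / (2 * \<alpha>^3) + \<gamma> / \<alpha>^2)
      \<and> (\<exists>L. L-lipschitz_on (spd_between \<alpha> \<beta>) (sym_grad (\<lambda>X. f X / 2))))
   \<and> (\<forall>q. (0 < q \<and> q < 1) \<or> (1 < q \<and> q < (real CARD('d) + 4) / (real CARD('d) + 2)) \<longrightarrow>
      (let g = g_qgauss n lam A \<gamma> q; d = real CARD('d); m = m_const q CARD('d) in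
        (\<forall>X \<in> spd_between \<alpha> \<beta>. has_sym_gradient g (sym_grad g X) X)
      \<and> (\<forall>X \<in> spd_between \<alpha> \<beta>. \<forall>Y \<in> spd_between \<alpha> \<beta>. X \<noteq> Y \<longrightarrow>
           norm (sym_grad g X - sym_grad g Y) / norm (X - Y)
             \<le> (if 1 < q
                 then \<beta>^2 / (2 * \<alpha>^3) + \<gamma> / \<alpha>^2
                      + \<gamma> * m / \<alpha>^2 * \<beta> powr ((q - 1) / 2 * d) * (1 + (q - 1) / 2 * d)
                 else \<beta>^2 / (2 * \<alpha>^3) + \<gamma> / \<alpha>^2
                      + \<gamma> * m * \<alpha> powr (- 2 + (q - 1) / 2 * d) * (1 + (1 - q) / 2 * d)))
      \<and> (\<exists>L. L-lipschitz_on (spd_between \<alpha> \<beta>) (sym_grad (\<lambda>X. g X / 2)))))"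
  unfolding Let_def
\<comment> \<open>separates the Gaussian from the \<open>q\<close>-Gaussian claim and keeps the three parts of each together\<close>
proof (intro conjI[of "_ \<and> _"] allI impI)
  note lam = assms(2,3) and \<gamma> = assms(4) and \<alpha> = assms(5) and A = assms(7)
  have \<beta>: "0 < \<beta>" using assms(5,6) by simp
  show "(\<forall>X \<in> spd_between \<alpha> \<beta>. has_sym_gradient (f_gauss n lam A \<gamma>) (sym_grad (f_gauss n lam A \<gamma>) X) X)
      \<and> (\<forall>X \<in> spd_between \<alpha> \<beta>. \<forall>Y \<in> spd_between \<alpha> \<beta>. X \<noteq> Y \<longrightarrow>
           norm (sym_grad (f_gauss n lam A \<gamma>) X - sym_grad (f_gauss n lam A \<gamma>) Y) / norm (X - Y)
             \<le> \<beta>^2 / (2 * \<alpha>^3) + \<gamma> / \<alpha>^2)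
      \<and> (\<exists>L. L-lipschitz_on (spd_between \<alpha> \<beta>) (sym_grad (\<lambda>X. f_gauss n lam A \<gamma> X / 2)))"
  proof (rule sym_grad_bounds_from_gradient[where L = "\<beta>\<^sup>2 / (2 * \<alpha> ^ 3) + \<gamma> * (1 / \<alpha>\<^sup>2)"])
    fix X Y :: "real^'d^'d" assume X: "X \<in> spd_between \<alpha> \<beta>" and Y: "Y \<in> spd_between \<alpha> \<beta>"
    show "has_sym_gradient (f_gauss n lam A \<gamma>)
        ((\<Sum>i=1..n. lam i *\<^sub>R (mat 1 - transport_matrix (A i) X)) - \<gamma> *\<^sub>R matrix_inv X) X"
      by (rule f_gauss_has_sym_gradient[OF \<alpha> A X])
    show "norm (((\<Sum>i=1..n. lam i *\<^sub>R (mat 1 - transport_matrix (A i) X)) - \<gamma> *\<^sub>R matrix_inv X)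
        - ((\<Sum>i=1..n. lam i *\<^sub>R (mat 1 - transport_matrix (A i) Y)) - \<gamma> *\<^sub>R matrix_inv Y))
      \<le> (\<beta>\<^sup>2 / (2 * \<alpha> ^ 3) + \<gamma> * (1 / \<alpha>\<^sup>2)) * norm (X - Y)"
      using norm_matrix_inv_diff_le[OF spd_betweenD(1,3)[OF X] spd_betweenD(1,3)[OF Y] \<alpha>]
      by (intro penalized_gradient_lipschitz \<alpha> A lam \<gamma> X Y) simp_all
  qed (use \<alpha> \<gamma> in auto)
  fix q :: real
  assume q: "(0 < q \<and> q < 1) \<or> (1 < q \<and> q < (real CARD('d) + 4) / (real CARD('d) + 2))"
  let ?d = "real CARD('d)" and ?m = "m_const q CARD('d)" and ?p = "(q - 1) / 2"
  \<comment> \<open>\<open>M\<close> bounds \<open>(det Z)\<^bsup>(q-1)/2\<^esup>\<close> on the order interval: the exponent is positive exactly if \<open>q > 1\<close>\<close>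
  define M where "M = (if 1 < q then \<beta> else \<alpha>) powr (?p * ?d)"
  have M: "det Z powr ?p \<le> M" if Z: "Z \<in> spd_between \<alpha> \<beta>" for Z :: "real^'d^'d"
  proof -
    have b: "\<alpha> powr ?d \<le> det Z" "det Z \<le> \<beta> powr ?d"
      using det_bounds[OF Z \<alpha>] \<alpha> \<beta> by (simp_all add: powr_realpow)
    have pos: "0 < det Z" using Z \<alpha> by (rule det_pos)
    show ?thesis
    proof (cases "1 < q")
      case True
      then have "det Z powr ?p \<le> (\<beta> powr ?d) powr ?p" using b pos by (intro powr_mono2) auto
      then show ?thesis using True by (simp add: M_def powr_powr mult.commute)
    next
      case False
      then have "det Z powr ?p \<le> (\<alpha> powr ?d) powr ?p" using b \<alpha> by (intro powr_mono2') auto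
      then show ?thesis using False by (simp add: M_def powr_powr mult.commute)
    qed
  qed
  let ?B = "M / \<alpha>\<^sup>2 * (1 + \<bar>?p\<bar> * ?d)"
  let ?L' = "if 1 < q
     then \<beta>^2 / (2 * \<alpha>^3) + \<gamma> / \<alpha>^2 + \<gamma> * ?m / \<alpha>^2 * \<beta> powr ((q - 1) / 2 * ?d) * (1 + (q - 1) / 2 * ?d)
     else \<beta>^2 / (2 * \<alpha>^3) + \<gamma> / \<alpha>^2 + \<gamma> * ?m * \<alpha> powr (- 2 + (q - 1) / 2 * ?d) * (1 + (1 - q) / 2 * ?d)"
  have m: "0 \<le> \<gamma> * ?m" using \<gamma> m_const_pos[OF q] by simp
  have L0: "0 \<le> \<beta>\<^sup>2 / (2 * \<alpha> ^ 3) + \<gamma> * ?m * ?B"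
    using m \<alpha> by (intro add_nonneg_nonneg mult_nonneg_nonneg[OF m] mult_nonneg_nonneg) (auto simp: M_def)
  have "?L' = \<beta>^2 / (2 * \<alpha>^3) + \<gamma> / \<alpha>^2 + \<gamma> * ?m * ?B"
  proof (cases "1 < q")
    case True
    then show ?thesis by (simp add: M_def)
  next
    case False
    have "\<alpha> powr (- 2 + ?p * ?d) = M / \<alpha>\<^sup>2"
      unfolding powr_add using False \<alpha> by (simp add: M_def powr_minus_divide powr_numeral)
    moreover have "(1 - q) / 2 = \<bar>?p\<bar>"
    proof -
      have "?p \<le> 0" using False by simp
      then have "\<bar>?p\<bar> = - ?p" by (rule abs_of_nonpos)
      also have "\<dots> = (1 - q) / 2" unfolding minus_divide_left minus_diff_eq ..
      finally show ?thesis ..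
    qed
    ultimately show ?thesis using False by (simp only: if_False mult.assoc)
  qed
  then have L': "\<beta>\<^sup>2 / (2 * \<alpha> ^ 3) + \<gamma> * ?m * ?B \<le> ?L'"
    using \<gamma> by simp
  show "(\<forall>X \<in> spd_between \<alpha> \<beta>. has_sym_gradient (g_qgauss n lam A \<gamma> q) (sym_grad (g_qgauss n lam A \<gamma> q) X) X)
      \<and> (\<forall>X \<in> spd_between \<alpha> \<beta>. \<forall>Y \<in> spd_between \<alpha> \<beta>. X \<noteq> Y \<longrightarrow>
           norm (sym_grad (g_qgauss n lam A \<gamma> q) X - sym_grad (g_qgauss n lam A \<gamma> q) Y) / norm (X - Y) \<le> ?L')
      \<and> (\<exists>L. L-lipschitz_on (spd_between \<alpha> \<beta>) (sym_grad (\<lambda>X. g_qgauss n lam A \<gamma> q X / 2)))"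
  proof (rule sym_grad_bounds_from_gradient[OF g_qgauss_has_sym_gradient[OF \<alpha> A _ q] L0 L'])
    fix X Y :: "real^'d^'d" assume X: "X \<in> spd_between \<alpha> \<beta>" and Y: "Y \<in> spd_between \<alpha> \<beta>"
    note R = det_powr_inverse_lipschitz[OF \<alpha> X Y M]
    show "norm (((\<Sum>i=1..n. lam i *\<^sub>R (mat 1 - transport_matrix (A i) X))
          - (\<gamma> * ?m) *\<^sub>R (det X powr ?p *\<^sub>R matrix_inv X))
        - ((\<Sum>i=1..n. lam i *\<^sub>R (mat 1 - transport_matrix (A i) Y))
          - (\<gamma> * ?m) *\<^sub>R (det Y powr ?p *\<^sub>R matrix_inv Y)))
      \<le> (\<beta>\<^sup>2 / (2 * \<alpha> ^ 3) + \<gamma> * ?m * ?B) * norm (X - Y)"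
      by (rule penalized_gradient_lipschitz[where R = "\<lambda>X. det X powr ?p *\<^sub>R matrix_inv X",
            OF \<alpha> A lam m R X Y])
  qed
qed

end
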